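(* Let $\mathsf{T}$ be an endofunctor on $\mathbf{Top}$ which preserves sobriety, $\Lambda$ a Scott-continuous characteristic geometric modal signature for $\mathsf{T}$, and $\Phi$ a set of proposition letters. Then the geometric $\mathsf{T}$-model $\mathfrak{Z} = (\mathbb{Z}, \zeta, V_{\mathbb{Z}})$ is final in $\mathbf{Mod}(\mathsf{T})$.
   Context: $\mathbf{Top}$: topological spaces and continuous maps. $\Omega\mathbb{X}$ is the set of opens of $\mathbb{X}$ and $\mathsf{opn}\,\mathbb{X}$ the same set viewed as a frame; both are contravariant via inverse image. An $n$-ary open predicate lifting for $\mathsf{T}$ is a natural transformation $\lambda : \Omega^n \to \Omega\circ\mathsf{T}$. A geometric modal signature $\Lambda$ for $\mathsf{T}$ is a collection of open predicate liftings. It is Scott-continuous if every $\lambda\in\Lambda$ satisfies, in each argument, $\lambda_{\mathbb{X}}(a_1,\dots,\bigcup A,\dots,a_n) = \bigcup_{b\in A}\lambda_{\mathbb{X}}(a_1,\dots,b,\dots,a_n)$ for all spaces $\mathbb{X}$ and all (nonempty) directed $A\subseteq\Omega\mathbb{X}$; it is characteristic if for every $\mathbb{X}$ the collection $\{\lambda_{\mathbb{X}}(a_1,\dots,a_n) \mid \lambda\in\Lambda\ n\text{-ary},\ a_i\in\Omega\mathbb{X}\}$ is a subbase for the topology of $\mathsf{T}\mathbb{X}$. A geometric $\mathsf{T}$-model is $\mathfrak{X} = (\mathbb{X},\gamma,V)$ with $\gamma:\mathbb{X}\to\mathsf{T}\mathbb{X}$ continuous and $V:\Phi\to\Omega\mathbb{X}$.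 A morphism $(\mathbb{X},\gamma,V)\to(\mathbb{X}',\gamma',V')$ is a continuous $f$ with $\gamma'\circ f = \mathsf{T}f\circ\gamma$ and $V = f^{-1}\circ V'$. These form the category $\mathbf{Mod}(\mathsf{T})$. Language $\mathrm{GML}(\Phi,\Lambda)$: $\varphi ::= \top\mid p\mid\varphi_1\wedge\varphi_2\mid\bigvee_{i\in I}\varphi_i\mid\heartsuit^{\lambda}(\varphi_1,\dots,\varphi_n)$, $p\in\Phi$, $I$ any index set, $\lambda\in\Lambda$ $n$-ary; $\bot:=\bigvee\emptyset$. Semantics on $\mathfrak{X}$: $[\![\top]\!]$ is the whole space, $[\![p]\!]=V(p)$, $\wedge,\bigvee$ are intersection and union, $[\![\heartsuit^{\lambda}(\varphi_1,\dots,\varphi_n)]\!]=\gamma^{-1}(\lambda_{\mathbb{X}}([\![\varphi_1]\!],\dots,[\![\varphi_n]\!]))$; $\mathfrak{X},x\Vdash\varphi$ iff $x\in[\![\varphi]\!]^{\mathfrak{X}}$. Construction of $\mathfrak{Z}$. Call $\varphi,\psi$ equivalent if $\mathfrak{X},x\Vdash\varphi$ iff $\mathfrak{X},x\Vdash\psi$ for all geometric $\mathsf{T}$-models $\mathfrak{X}$ and states $x$; $[\varphi]$ is the equivalence class, and $\mathbf{E}$ the collection of all classes. Under the assumptions $\mathbf{E}$ is a set, and it is a frame with $\top=[\top]$, $\bot=[\bot]$, $[\varphi]\wedge[\psi]=[\varphi\wedge\psi]$, $\bigvee_i[\varphi_i]=[\bigvee_i\varphi_i]$. For a frame $F$, $\mathsf{pt}F$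 is the space of frame homomorphisms $p:F\to 2$ (with $2$ the two-element frame) with opens $\tilde a=\{p\mid p(a)=\top\}$, $a\in F$; $\mathsf{pt}$ is contravariant by precomposition. Spaces of the form $\mathsf{pt}F$ are sober, and for sober $\mathbb{Y}$ the map $k_{\mathbb{Y}}:\mathbb{Y}\to\mathsf{pt}(\mathsf{opn}\,\mathbb{Y})$, sending $y$ to the point $p_y$ with $p_y(a)=\top$ iff $y\in a$, is a homeomorphism. Put $\mathbb{Z}=\mathsf{pt}\mathbf{E}$. Let $\delta:\mathsf{opn}(\mathsf{T}\mathbb{Z})\to\mathbf{E}$ be the (well-defined) frame homomorphism determined on generators by $\lambda_{\mathbb{Z}}(\widetilde{[\varphi_1]},\dots,\widetilde{[\varphi_n]})\mapsto[\heartsuit^{\lambda}(\varphi_1,\dots,\varphi_n)]$, $\lambda\in\Lambda$, $\varphi_i\in\mathrm{GML}(\Phi,\Lambda)$. Let $\zeta = k_{\mathsf{T}\mathbb{Z}}^{-1}\circ\mathsf{pt}\,\delta:\mathbb{Z}\to\mathsf{T}\mathbb{Z}$ and $V_{\mathbb{Z}}(p)=\widetilde{[p]}$ for $p\in\Phi$. Preserving sobriety means that $\mathsf{T}\mathbb{X}$ is sober whenever $\mathbb{X}$ is. *)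

theory Defs
  imports "HOL-Analysis.Abstract_Topology_2" "HOL-Library.Equipollence" "HOL-Library.FuncSet"
begin

section \<open>The category of topological spaces\<close>

text \<open>
  All points are drawn from a type \<open>'u\<close>, and \<open>\<U>\<close> is the family of those subsets of \<open>'u\<close>
  that count as "sets". The only closure condition in \<open>universe\<close> is that whatever is no larger
  than a set is a set; so \<open>\<U>\<close> may consist of all subsets of \<open>'u\<close>, or of the subsets of
  cardinality less than that of \<open>'u\<close>. In particular, if the cardinality of \<open>'u\<close> is strongly
  inaccessible, the latter choice is a Grothendieck universe, up to the names of the points.
\<close>

definition universe :: "'u set set \<Rightarrow> bool" where
  "universe \<U> \<longleftrightarrow> (\<forall>A\<in>\<U>. \<forall>B. B \<lesssim> A \<longrightarrow> B \<in> \<U>)"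

definition Top :: "'u set set \<Rightarrow> 'u topology set" where
  "Top \<U> = {X. topspace X \<in> \<U>}"

text \<open>Arrows are extensional (\<open>undefined\<close> outside the domain), so that equality of arrows is
  equality in HOL.\<close>

definition top_hom :: "'u topology \<Rightarrow> 'v topology \<Rightarrow> ('u \<Rightarrow> 'v) set" where
  "top_hom X Y = {f. continuous_map X Y f \<and> f \<in> extensional (topspace X)}"

definition opens :: "'u topology \<Rightarrow> 'u set set" where
  "opens X = {a. openin X a}"

definition inv_img :: "'u topology \<Rightarrow> ('u \<Rightarrow> 'v) \<Rightarrow> 'v set \<Rightarrow> 'u set" where
  "inv_img X f a = {x \<in> topspace X. f x \<in> a}"

text \<open>In \<open>arr T X Y f\<close>, the spaces \<open>X\<close> and \<open>Y\<close> are the domain and the codomain of \<open>f\<close>.\<close>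

record 'u endofun =
  obj :: "'u topology \<Rightarrow> 'u topology"
  arr :: "'u topology \<Rightarrow> 'u topology \<Rightarrow> ('u \<Rightarrow> 'u) \<Rightarrow> ('u \<Rightarrow> 'u)"

definition endofunctor :: "'u set set \<Rightarrow> 'u endofun \<Rightarrow> bool" where
  "endofunctor \<U> T \<longleftrightarrow>
     (\<forall>X\<in>Top \<U>. obj T X \<in> Top \<U>) \<and>
     (\<forall>X\<in>Top \<U>. \<forall>Y\<in>Top \<U>. \<forall>f\<in>top_hom X Y. arr T X Y f \<in> top_hom (obj T X) (obj T Y)) \<and>
     (\<forall>X\<in>Top \<U>. arr T X X (\<lambda>x\<in>topspace X. x) = (\<lambda>t\<in>topspace (obj T X). t)) \<and>
     (\<forall>X\<in>Top \<U>. \<forall>Y\<in>Top \<U>. \<forall>Z\<in>Top \<U>. \<forall>f\<in>top_hom X Y. \<forall>g\<in>top_hom Y Z.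
        arr T X Z (compose (topspace X) g f)
          = compose (topspace (obj T X)) (arr T Y Z g) (arr T X Y f))"

definition irreducible_closed :: "'u topology \<Rightarrow> 'u set \<Rightarrow> bool" where
  "irreducible_closed X C \<longleftrightarrow> closedin X C \<and> C \<noteq> {} \<and>
     (\<forall>A B. closedin X A \<and> closedin X B \<and> C \<subseteq> A \<union> B \<longrightarrow> C \<subseteq> A \<or> C \<subseteq> B)"

definition sober :: "'u topology \<Rightarrow> bool" where
  "sober X \<longleftrightarrow>
     (\<forall>C. irreducible_closed X C \<longrightarrow> (\<exists>!x. x \<in> topspace X \<and> X closure_of {x} = C))"

definition preserves_sobriety :: "'u set set \<Rightarrow> 'u endofun \<Rightarrow> bool" where
  "preserves_sobriety \<U> T \<longleftrightarrow> (\<forall>X\<in>Top \<U>. sober X \<longrightarrow> sober (obj T X))"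


section \<open>Open predicate liftings\<close>

text \<open>The argument tuple of an \<open>n\<close>-ary lifting is a list of length \<open>n\<close>.\<close>

record 'u lifting =
  arity :: nat
  lift :: "'u topology \<Rightarrow> 'u set list \<Rightarrow> 'u set"

definition open_tuples :: "'u topology \<Rightarrow> nat \<Rightarrow> 'u set list set" where
  "open_tuples X n = {as. length as = n \<and> set as \<subseteq> opens X}"

definition open_predicate_lifting :: "'u set set \<Rightarrow> 'u endofun \<Rightarrow> 'u lifting \<Rightarrow> bool" where
  "open_predicate_lifting \<U> T l \<longleftrightarrow>
     (\<forall>X\<in>Top \<U>. \<forall>as\<in>open_tuples X (arity l). lift l X as \<in> opens (obj T X)) \<and>
     (\<forall>X\<in>Top \<U>. \<forall>Y\<in>Top \<U>. \<forall>f\<in>top_hom X Y. \<forall>as\<in>open_tuples Y (arity l).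
        lift l X (map (inv_img X f) as) = inv_img (obj T X) (arr T X Y f) (lift l Y as))"

definition modal_signature :: "'u set set \<Rightarrow> 'u endofun \<Rightarrow> 'u lifting set \<Rightarrow> bool" where
  "modal_signature \<U> T \<Lambda> \<longleftrightarrow> (\<forall>l\<in>\<Lambda>. open_predicate_lifting \<U> T l)"

definition directed :: "'u set set \<Rightarrow> bool" where
  "directed A \<longleftrightarrow> A \<noteq> {} \<and> (\<forall>a\<in>A. \<forall>b\<in>A. \<exists>c\<in>A. a \<subseteq> c \<and> b \<subseteq> c)"

definition scott_continuous :: "'u set set \<Rightarrow> 'u lifting set \<Rightarrow> bool" where
  "scott_continuous \<U> \<Lambda> \<longleftrightarrow>
     (\<forall>l\<in>\<Lambda>. \<forall>X\<in>Top \<U>. \<forall>as\<in>open_tuples X (arity l). \<forall>i<arity l.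
        \<forall>A. A \<subseteq> opens X \<and> directed A \<longrightarrow>
          lift l X (as[i := \<Union>A]) = (\<Union>b\<in>A. lift l X (as[i := b])))"

text \<open>The intersection of no sets is the whole space. (With \<^const>\<open>topology_generated_by\<close>
  a subbase would have to cover the space.)\<close>

definition subbase_of :: "'u set set \<Rightarrow> 'u topology \<Rightarrow> bool" where
  "subbase_of S Y \<longleftrightarrow>
     topology (arbitrary union_of (finite intersection_of (\<lambda>a. a \<in> S) relative_to topspace Y)) = Y"

definition characteristic :: "'u set set \<Rightarrow> 'u endofun \<Rightarrow> 'u lifting set \<Rightarrow> bool" where
  "characteristic \<U> T \<Lambda> \<longleftrightarrow>
     (\<forall>X\<in>Top \<U>.
        subbase_of {lift l X as | l as. l \<in> \<Lambda> \<and> as \<in> open_tuples X (arity l)} (obj T X))"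


section \<open>Models and formulas\<close>

record ('u, 'p) gmodel =
  state_space :: "'u topology"
  structure_map :: "'u \<Rightarrow> 'u"
  valuation :: "'p \<Rightarrow> 'u set"

definition Mod_ob :: "'u set set \<Rightarrow> 'u endofun \<Rightarrow> 'p set \<Rightarrow> ('u, 'p) gmodel set" where
  "Mod_ob \<U> T \<Phi> =
     {M. state_space M \<in> Top \<U> \<and>
         structure_map M \<in> top_hom (state_space M) (obj T (state_space M)) \<and>
         valuation M \<in> \<Phi> \<rightarrow>\<^sub>E opens (state_space M)}"

definition Mod_hom ::
    "'u endofun \<Rightarrow> 'p set \<Rightarrow> ('u, 'p) gmodel \<Rightarrow> ('u, 'p) gmodel \<Rightarrow> ('u \<Rightarrow> 'u) set" where
  "Mod_hom T \<Phi> M N =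
     {f \<in> top_hom (state_space M) (state_space N).
        compose (topspace (state_space M)) (structure_map N) f
          = compose (topspace (state_space M))
              (arr T (state_space M) (state_space N) f) (structure_map M) \<and>
        (\<forall>p\<in>\<Phi>. valuation M p = inv_img (state_space M) f (valuation N p))}"

definition final_object :: "'o set \<Rightarrow> ('o \<Rightarrow> 'o \<Rightarrow> 'h set) \<Rightarrow> 'o \<Rightarrow> bool" where
  "final_object Ob Hom z \<longleftrightarrow> z \<in> Ob \<and> (\<forall>x\<in>Ob. \<exists>!f. f \<in> Hom x z)"

text \<open>\<open>Disj I f\<close> is the disjunction of the \<open>f i\<close> with \<open>i \<in> I\<close>; the values of \<open>f\<close> outside \<open>I\<close>
  are irrelevant. Index sets are subsets of \<open>'u\<close>, and the formulas of the language are the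
  elements of \<open>GML\<close>, where the index sets belong to the universe.\<close>

datatype ('u, 'p) formula =
    Truth
  | Letter 'p
  | Conj "('u, 'p) formula" "('u, 'p) formula"
  | Disj "'u set" "'u \<Rightarrow> ('u, 'p) formula"
  | Heart "'u lifting" "('u, 'p) formula list"

inductive_set GML :: "'u set set \<Rightarrow> 'u lifting set \<Rightarrow> 'p set \<Rightarrow> ('u, 'p) formula set"
  for \<U> :: "'u set set" and \<Lambda> :: "'u lifting set" and \<Phi> :: "'p set" where
  "Truth \<in> GML \<U> \<Lambda> \<Phi>"
| "p \<in> \<Phi> \<Longrightarrow> Letter p \<in> GML \<U> \<Lambda> \<Phi>"
| "\<phi> \<in> GML \<U> \<Lambda> \<Phi> \<Longrightarrow> \<psi> \<in> GML \<U> \<Lambda> \<Phi> \<Longrightarrow> Conj \<phi> \<psi> \<in> GML \<U> \<Lambda> \<Phi>"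
| "I \<in> \<U> \<Longrightarrow> (\<And>i. i \<in> I \<Longrightarrow> f i \<in> GML \<U> \<Lambda> \<Phi>) \<Longrightarrow> Disj I f \<in> GML \<U> \<Lambda> \<Phi>"
| "l \<in> \<Lambda> \<Longrightarrow> length \<phi>s = arity l \<Longrightarrow> (\<And>\<phi>. \<phi> \<in> set \<phi>s \<Longrightarrow> \<phi> \<in> GML \<U> \<Lambda> \<Phi>)
     \<Longrightarrow> Heart l \<phi>s \<in> GML \<U> \<Lambda> \<Phi>"

primrec sem :: "('u, 'p) gmodel \<Rightarrow> ('u, 'p) formula \<Rightarrow> 'u set" where
  "sem M Truth = topspace (state_space M)"
| "sem M (Letter p) = valuation M p"
| "sem M (Conj \<phi> \<psi>) = sem M \<phi> \<inter> sem M \<psi>"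
| "sem M (Disj I f) = (\<Union>i\<in>I. sem M (f i))"
| "sem M (Heart l \<phi>s) =
     inv_img (state_space M) (structure_map M) (lift l (state_space M) (map (sem M) \<phi>s))"

definition equivalent ::
    "'u set set \<Rightarrow> 'u endofun \<Rightarrow> 'p set \<Rightarrow> ('u, 'p) formula \<Rightarrow> ('u, 'p) formula \<Rightarrow> bool" where
  "equivalent \<U> T \<Phi> \<phi> \<psi> \<longleftrightarrow>
     (\<forall>M\<in>Mod_ob \<U> T \<Phi>. \<forall>x\<in>topspace (state_space M). x \<in> sem M \<phi> \<longleftrightarrow> x \<in> sem M \<psi>)"

definition fclass ::
    "'u set set \<Rightarrow> 'u endofun \<Rightarrow> 'u lifting set \<Rightarrow> 'p set \<Rightarrow> ('u, 'p) formula \<Rightarrow> ('u, 'p) formula set"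
  where "fclass \<U> T \<Lambda> \<Phi> \<phi> = {\<psi> \<in> GML \<U> \<Lambda> \<Phi>. equivalent \<U> T \<Phi> \<phi> \<psi>}"


section \<open>Frames and their points\<close>

text \<open>A frame is given by its carrier and operations; \<open>fjoin\<close> is only meaningful on subsets of
  the carrier.\<close>

record 'a frame_ops =
  fcarrier :: "'a set"
  ftop :: 'a
  fmeet :: "'a \<Rightarrow> 'a \<Rightarrow> 'a"
  fjoin :: "'a set \<Rightarrow> 'a"

definition frame_hom :: "'a frame_ops \<Rightarrow> 'b frame_ops \<Rightarrow> ('a \<Rightarrow> 'b) set" where
  "frame_hom F G =
     {h \<in> fcarrier F \<rightarrow>\<^sub>E fcarrier G.
        h (ftop F) = ftop G \<and>
        (\<forall>a\<in>fcarrier F. \<forall>b\<in>fcarrier F. h (fmeet F a b) = fmeet G (h a) (h b)) \<and>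
        (\<forall>A. A \<subseteq> fcarrier F \<longrightarrow> h (fjoin F A) = fjoin G (h ` A))}"

definition two :: "bool frame_ops" where
  "two = \<lparr>fcarrier = UNIV, ftop = True, fmeet = (\<and>), fjoin = (\<lambda>A. True \<in> A)\<rparr>"

definition opn :: "'u topology \<Rightarrow> 'u set frame_ops" where
  "opn X = \<lparr>fcarrier = opens X, ftop = topspace X, fmeet = (\<inter>), fjoin = Union\<rparr>"

definition tilde :: "'a frame_ops \<Rightarrow> 'a \<Rightarrow> ('a \<Rightarrow> bool) set" where
  "tilde F a = {p \<in> frame_hom F two. p a}"

definition pt :: "'a frame_ops \<Rightarrow> ('a \<Rightarrow> bool) topology" where
  "pt F = topology (\<lambda>W. \<exists>a\<in>fcarrier F. W = tilde F a)"

text \<open>\<open>pt_map F h : pt G \<rightarrow> pt F\<close> for \<open>h : F \<rightarrow> G\<close>.\<close>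

definition pt_map :: "'a frame_ops \<Rightarrow> ('a \<Rightarrow> 'b) \<Rightarrow> ('b \<Rightarrow> bool) \<Rightarrow> ('a \<Rightarrow> bool)" where
  "pt_map F h p = compose (fcarrier F) p h"

definition kmap :: "'u topology \<Rightarrow> 'u \<Rightarrow> ('u set \<Rightarrow> bool)" where
  "kmap Y y = (\<lambda>a\<in>opens Y. y \<in> a)"

definition EE ::
    "'u set set \<Rightarrow> 'u endofun \<Rightarrow> 'u lifting set \<Rightarrow> 'p set \<Rightarrow> ('u, 'p) formula set frame_ops" where
  "EE \<U> T \<Lambda> \<Phi> =
     \<lparr>fcarrier = fclass \<U> T \<Lambda> \<Phi> ` GML \<U> \<Lambda> \<Phi>,
      ftop = fclass \<U> T \<Lambda> \<Phi> Truth,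
      fmeet = (\<lambda>a b. THE c. \<exists>\<phi>\<in>GML \<U> \<Lambda> \<Phi>. \<exists>\<psi>\<in>GML \<U> \<Lambda> \<Phi>.
                 a = fclass \<U> T \<Lambda> \<Phi> \<phi> \<and> b = fclass \<U> T \<Lambda> \<Phi> \<psi> \<and>
                 c = fclass \<U> T \<Lambda> \<Phi> (Conj \<phi> \<psi>)),
      fjoin = (\<lambda>A. THE c. \<exists>I f. Disj I f \<in> GML \<U> \<Lambda> \<Phi> \<and>
                 A = (\<lambda>i. fclass \<U> T \<Lambda> \<Phi> (f i)) ` I \<and>
                 c = fclass \<U> T \<Lambda> \<Phi> (Disj I f))\<rparr>"


section \<open>The final model\<close>

text \<open>
  The points of \<open>pt (EE \<U> T \<Lambda> \<Phi>)\<close> are not of type \<open>'u\<close>, so this space is not literally an object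
  of \<open>Top \<U>\<close>. Below, \<open>Z\<close> is an object of \<open>Top \<U>\<close> and \<open>h : pt (EE \<U> T \<Lambda> \<Phi>) \<rightarrow> Z\<close> is a
  homeomorphism, along which the construction is transported.
\<close>

definition Zopen ::
    "'u set set \<Rightarrow> 'u endofun \<Rightarrow> 'u lifting set \<Rightarrow> 'p set
      \<Rightarrow> ((('u, 'p) formula set \<Rightarrow> bool) \<Rightarrow> 'u) \<Rightarrow> ('u, 'p) formula \<Rightarrow> 'u set" where
  "Zopen \<U> T \<Lambda> \<Phi> h \<phi> = h ` tilde (EE \<U> T \<Lambda> \<Phi>) (fclass \<U> T \<Lambda> \<Phi> \<phi>)"

definition delta ::
    "'u set set \<Rightarrow> 'u endofun \<Rightarrow> 'u lifting set \<Rightarrow> 'p set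
      \<Rightarrow> 'u topology \<Rightarrow> ((('u, 'p) formula set \<Rightarrow> bool) \<Rightarrow> 'u) \<Rightarrow> 'u set \<Rightarrow> ('u, 'p) formula set" where
  "delta \<U> T \<Lambda> \<Phi> Z h =
     (THE d. d \<in> frame_hom (opn (obj T Z)) (EE \<U> T \<Lambda> \<Phi>) \<and>
        (\<forall>l\<in>\<Lambda>. \<forall>\<phi>s. length \<phi>s = arity l \<and> set \<phi>s \<subseteq> GML \<U> \<Lambda> \<Phi> \<longrightarrow>
           d (lift l Z (map (Zopen \<U> T \<Lambda> \<Phi> h) \<phi>s)) = fclass \<U> T \<Lambda> \<Phi> (Heart l \<phi>s)))"

definition zeta ::
    "'u set set \<Rightarrow> 'u endofun \<Rightarrow> 'u lifting set \<Rightarrow> 'p set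
      \<Rightarrow> 'u topology \<Rightarrow> ((('u, 'p) formula set \<Rightarrow> bool) \<Rightarrow> 'u) \<Rightarrow> 'u \<Rightarrow> 'u" where
  "zeta \<U> T \<Lambda> \<Phi> Z h =
     (\<lambda>z\<in>topspace Z.
        inv_into (topspace (obj T Z)) (kmap (obj T Z))
          (pt_map (opn (obj T Z)) (delta \<U> T \<Lambda> \<Phi> Z h)
            (inv_into (topspace (pt (EE \<U> T \<Lambda> \<Phi>))) h z)))"

definition ZZ ::
    "'u set set \<Rightarrow> 'u endofun \<Rightarrow> 'u lifting set \<Rightarrow> 'p set
      \<Rightarrow> 'u topology \<Rightarrow> ((('u, 'p) formula set \<Rightarrow> bool) \<Rightarrow> 'u) \<Rightarrow> ('u, 'p) gmodel" where
  "ZZ \<U> T \<Lambda> \<Phi> Z h =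
     \<lparr>state_space = Z,
      structure_map = zeta \<U> T \<Lambda> \<Phi> Z h,
      valuation = (\<lambda>p\<in>\<Phi>. Zopen \<U> T \<Lambda> \<Phi> h (Letter p))\<rparr>"

end

(*
  Every formula is equivalent to the disjunction of the finitary formulas below it: Scott-continuity
  pushes directed joins out of the modalities, one argument at a time. There are at most
  |nat + \<Lambda> + \<Phi>| finitary formulas, and a class of formulas, as well as a point of the frame E, is
  determined by a set of finitary formulas. Hence E and pt E are small.

  In every model M, a state is sent by the theory map to the point of Z that consists of the classes
  it satisfies. Pulling an open W of T Z back along the coalgebra structure of M and T applied to
  the theory map yields the truth set of a formula that does not depend on M, because this holds for
  the subbase given by the liftings (naturality) and is preserved by finite intersections and unions.
  Truth sets in all models separate the elements of E, so this formula determines the class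
  \<delta> W; thus \<delta> is a well-defined homomorphism. As T Z is sober, \<delta> gives the structure map \<zeta>, for which
  each basic open of Z is the truth set of its formula. So theory maps are model morphisms, and any
  morphism into Z preserves truth and is therefore the theory map.
*)

theory Submission
  imports Defs
begin

section \<open>Words over an infinite alphabet, and transport of a topology along an
  injection\<close>

text \<open>Since \<open>A \<times> A\<close> embeds into \<open>A\<close>, so by induction does
  each layer of words of a fixed length; a countable union of such layers still fits because
  \<open>A\<close> is infinite.\<close>

lemma lepoll_lists_infinite:
  assumes "infinite A"
  shows "lists A \<lesssim> A"
proof -
  have pairs: "A \<times> A \<lesssim> A"
    using card_of_Times_same_infinite[OF assms] eqpoll_iff_card_of_ordIso eqpoll_imp_lepoll by blast
  have len: "{xs \<in> lists A. length xs = n} \<lesssim> A" for n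
  proof (induction n)
    case 0
    have "{xs \<in> lists A. length xs = 0} = {[]}"
      by auto
    then show ?case
      using assms by (simp add: finite_lepoll_infinite)
  next
    case (Suc n)
    have "{xs \<in> lists A. length xs = Suc n} \<subseteq>
        (\<lambda>(x, xs). x # xs) ` (A \<times> {xs \<in> lists A. length xs = n})"
      by (auto simp: length_Suc_conv image_iff)
    then have "{xs \<in> lists A. length xs = Suc n} \<lesssim> A \<times> {xs \<in> lists A. length xs = n}"
      by (rule subset_image_lepoll)
    also have "\<dots> \<lesssim> A \<times> A"
      by (intro times_lepoll_mono Suc lepoll_refl)
    finally show ?case
      using pairs lepoll_trans by blast
  qed
  have "(card_of (\<Union>n\<in>UNIV. {xs \<in> lists A. length xs = n}), card_of A) \<in> ordLeq"
    using assms len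
    by (intro card_of_UNION_ordLeq_infinite)
       (auto simp: infinite_iff_card_of_nat lepoll_def card_of_ordLeq[symmetric])
  moreover have "(\<Union>n\<in>UNIV. {xs \<in> lists A. length xs = n}) = lists A"
    by auto
  ultimately show ?thesis
    by (simp add: lepoll_def card_of_ordLeq)
qed

text \<open>This is what later replaces \<open>pt E\<close>, whose points are functions on classes
  of formulas, by a space with points of type \<open>'u\<close>.\<close>

lemma lepoll_imp_homeomorphic_space:
  assumes "topspace X \<lesssim> (A :: 'b set)"
  obtains Y f where "topspace (Y :: 'b topology) \<lesssim> A" "homeomorphic_map X Y f"
proof -
  obtain f where inj: "inj_on f (topspace X)" and sub: "f ` topspace X \<subseteq> A"
    using assms by (auto simp: lepoll_def)
  \<comment> \<open>The quotient topology on the image of \<open>f\<close>. A homeomorphic map is by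
    definition an injective quotient map, so injectivity of \<open>f\<close> is all that
    remains.\<close>
  define Y where
    "Y = topology (\<lambda>W. W \<subseteq> f ` topspace X \<and> openin X {x \<in> topspace X. f x \<in> W})"
  have "istopology (\<lambda>W. W \<subseteq> f ` topspace X \<and> openin X {x \<in> topspace X. f x \<in> W})"
    unfolding istopology_def
  proof (intro conjI allI impI)
    fix S R
    assume S: "S \<subseteq> f ` topspace X \<and> openin X {x \<in> topspace X. f x \<in> S}"
      and R: "R \<subseteq> f ` topspace X \<and> openin X {x \<in> topspace X. f x \<in> R}"
    show "S \<inter> R \<subseteq> f ` topspace X"
      using S by blast
    have eq: "{x \<in> topspace X. f x \<in> S \<inter> R} =
        {x \<in> topspace X. f x \<in> S} \<inter> {x \<in> topspace X. f x \<in> R}"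
      by blast
    show "openin X {x \<in> topspace X. f x \<in> S \<inter> R}"
      unfolding eq using S R by (intro openin_Int) auto
  next
    fix \<K>
    assume K: "\<forall>K\<in>\<K>. K \<subseteq> f ` topspace X \<and> openin X {x \<in> topspace X. f x \<in> K}"
    then show "\<Union>\<K> \<subseteq> f ` topspace X"
      by blast
    have eq: "{x \<in> topspace X. f x \<in> \<Union>\<K>} = (\<Union>K\<in>\<K>. {x \<in> topspace X. f x \<in> K})"
      by blast
    show "openin X {x \<in> topspace X. f x \<in> \<Union>\<K>}"
      unfolding eq using K by (intro openin_Union) auto
  qed
  then have open_Y: "openin Y W \<longleftrightarrow> W \<subseteq> f ` topspace X \<and> openin X {x \<in> topspace X. f x \<in> W}" for W
    by (simp add: Y_def topology_inverse')
  have "{x \<in> topspace X. f x \<in> f ` topspace X} = topspace X"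
    by blast
  then have "openin Y (f ` topspace X)"
    by (simp add: open_Y)
  then have top_Y: "topspace Y = f ` topspace X"
    by (metis open_Y openin_subset openin_topspace subset_antisym)
  have "topspace Y \<lesssim> A"
    using sub by (simp add: top_Y subset_imp_lepoll)
  moreover have "homeomorphic_map X Y f"
    using inj by (simp add: homeomorphic_map_def quotient_map_def top_Y open_Y)
  ultimately show thesis
    using that by blast
qed

section \<open>Sobriety and points of frames\<close>

text \<open>Points of a frame read as completely prime filters, the form in which they are used
  below.\<close>

lemma in_frame_hom_two:
  "p \<in> frame_hom F two \<longleftrightarrow>
     p \<in> extensional (fcarrier F) \<and> p (ftop F) \<and>
     (\<forall>a\<in>fcarrier F. \<forall>b\<in>fcarrier F. p (fmeet F a b) \<longleftrightarrow> p a \<and> p b) \<and>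
     (\<forall>A\<subseteq>fcarrier F. p (fjoin F A) \<longleftrightarrow> (\<exists>a\<in>A. p a))"
  by (auto simp: frame_hom_def two_def PiE_def image_iff)

lemma in_frame_hom_opn_two:
  "p \<in> frame_hom (opn Y) two \<longleftrightarrow>
     p \<in> extensional (opens Y) \<and> p (topspace Y) \<and>
     (\<forall>a\<in>opens Y. \<forall>b\<in>opens Y. p (a \<inter> b) \<longleftrightarrow> p a \<and> p b) \<and>
     (\<forall>A\<subseteq>opens Y. p (\<Union>A) \<longleftrightarrow> (\<exists>a\<in>A. p a))"
  by (simp add: in_frame_hom_two opn_def)

lemma kmap_in_frame_hom: "y \<in> topspace Y \<Longrightarrow> kmap Y y \<in> frame_hom (opn Y) two"
  by (auto simp: in_frame_hom_opn_two kmap_def opens_def)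

text \<open>Irreducibility, applied to complements, says that if two opens meet \<open>C\<close>
  then so does their intersection. The top is preserved because \<open>C\<close> is nonempty, and
  unions are preserved by any set \<open>C\<close>.\<close>

lemma irreducible_closed_imp_point:
  assumes "irreducible_closed Y C"
  shows "(\<lambda>a\<in>opens Y. a \<inter> C \<noteq> {}) \<in> frame_hom (opn Y) two"
proof -
  have C: "closedin Y C" "C \<noteq> {}"
    "\<And>A B. closedin Y A \<Longrightarrow> closedin Y B \<Longrightarrow> C \<subseteq> A \<union> B \<Longrightarrow> C \<subseteq> A \<or> C \<subseteq> B"
    using assms by (auto simp: irreducible_closed_def)
  have sub: "C \<subseteq> topspace Y"
    using C(1) by (rule closedin_subset)
  have "a \<inter> b \<inter> C \<noteq> {}" if "openin Y a" "openin Y b" "a \<inter> C \<noteq> {}" "b \<inter> C \<noteq> {}" for a b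
    using C(3)[of "topspace Y - a" "topspace Y - b"] that sub by blast
  then show ?thesis
    using C(2) sub
    by (auto simp: in_frame_hom_opn_two opens_def subset_iff)
qed

text \<open>The inverse construction: the closed set is the complement of the largest open that
  \<open>p\<close> rejects. An open is accepted exactly if it is not contained in that largest one,
  and preservation of intersections becomes irreducibility.\<close>

lemma point_imp_irreducible_closed:
  assumes "p \<in> frame_hom (opn Y) two"
  shows "irreducible_closed Y (topspace Y - \<Union>{a \<in> opens Y. \<not> p a})"
    and "\<And>a. openin Y a \<Longrightarrow> p a \<longleftrightarrow> a \<inter> (topspace Y - \<Union>{a \<in> opens Y. \<not> p a}) \<noteq> {}"
proof -
  let ?C = "topspace Y - \<Union>{a \<in> opens Y. \<not> p a}"
  have p: "p (topspace Y)" "\<And>a b. openin Y a \<Longrightarrow> openin Y b \<Longrightarrow> p (a \<inter> b) \<longleftrightarrow> p a \<and> p b"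
    "\<And>A. (\<And>a. a \<in> A \<Longrightarrow> openin Y a) \<Longrightarrow> p (\<Union>A) \<longleftrightarrow> (\<exists>a\<in>A. p a)"
    using assms by (auto simp: in_frame_hom_opn_two opens_def subset_iff)
  let ?N = "\<Union>{a \<in> opens Y. \<not> p a}"
  \<comment> \<open>As \<open>p\<close> preserves unions, the union of all rejected opens is itself
    rejected.\<close>
  have N: "openin Y ?N" "\<not> p ?N"
    using p(3)[of "{a \<in> opens Y. \<not> p a}"] by (auto simp: opens_def)
  have mono: "p b" if "openin Y a" "openin Y b" "a \<subseteq> b" "p a" for a b
    using p(2)[of a b] that by (simp add: Int_absorb2)
  show meets: "p a \<longleftrightarrow> a \<inter> ?C \<noteq> {}" if "openin Y a" for a
  proof
    assume "p a"
    then have "\<not> a \<subseteq> ?N"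
      using mono N that by blast
    then show "a \<inter> ?C \<noteq> {}"
      using openin_subset[OF that] by blast
  next
    show "p a" if "a \<inter> ?C \<noteq> {}"
      using that \<open>openin Y a\<close> by (auto simp: opens_def)
  qed
  show "irreducible_closed Y ?C"
    unfolding irreducible_closed_def
  proof (intro conjI allI impI)
    show "closedin Y ?C"
      using N(1) by blast
    show "?C \<noteq> {}"
      using meets[of "topspace Y"] p(1) by auto
    fix A B
    assume AB: "closedin Y A \<and> closedin Y B \<and> ?C \<subseteq> A \<union> B"
    then have AB': "openin Y (topspace Y - A)" "openin Y (topspace Y - B)"
      by auto
    moreover have "(topspace Y - A) \<inter> (topspace Y - B) \<inter> ?C = {}"
      using AB by blast
    ultimately have "(topspace Y - A) \<inter> ?C = {} \<or> (topspace Y - B) \<inter> ?C = {}"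
      using p(2)[OF AB'] meets by (metis openin_Int)
    then show "?C \<subseteq> A \<or> ?C \<subseteq> B"
      by blast
  qed
qed

text \<open>A closed set is determined by the opens that meet it, and an open meets the closure of
  \<open>{x}\<close> exactly if it contains \<open>x\<close>.\<close>

lemma closure_of_singleton_eq_closed_iff:
  assumes "closedin Y C" "x \<in> topspace Y"
  shows "Y closure_of {x} = C \<longleftrightarrow> kmap Y x = (\<lambda>a\<in>opens Y. a \<inter> C \<noteq> {})"
proof
  assume C: "Y closure_of {x} = C"
  have "x \<in> a \<longleftrightarrow> a \<inter> C \<noteq> {}" if "openin Y a" for a
    using openin_Int_closure_of_eq_empty[OF that, of "{x}"] C by auto
  then show "kmap Y x = (\<lambda>a\<in>opens Y. a \<inter> C \<noteq> {})"
    by (auto simp: kmap_def opens_def restrict_def)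
next
  assume eq: "kmap Y x = (\<lambda>a\<in>opens Y. a \<inter> C \<noteq> {})"
  then have x: "x \<in> a \<longleftrightarrow> a \<inter> C \<noteq> {}" if "openin Y a" for a
  proof -
    have "kmap Y x a \<longleftrightarrow> (\<lambda>a\<in>opens Y. a \<inter> C \<noteq> {}) a"
      by (simp only: eq)
    then show ?thesis
      using that by (simp add: kmap_def opens_def)
  qed
  have "x \<in> C"
    using x[of "topspace Y - C"] assms by auto
  moreover have "z \<in> Y closure_of {x}" if "z \<in> C" for z
    using that x closedin_subset[OF assms(1)] by (auto simp: in_closure_of)
  ultimately show "Y closure_of {x} = C"
    using assms(1) by (auto intro: closure_of_minimal[THEN subsetD])
qed

text \<open>Irreducible closed sets correspond to points of \<open>opn Y\<close>, and under this
  correspondence the generic points of a closed set are the preimages under \<open>kmap Y\<close>.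
  This turns sobriety into the invertibility of \<open>kmap\<close> on which \<open>zeta\<close>
  relies.\<close>

lemma sober_iff_bij_betw_kmap:
  "sober Y \<longleftrightarrow> bij_betw (kmap Y) (topspace Y) (frame_hom (opn Y) two)"
proof
  assume sober: "sober Y"
  have "\<exists>!x. x \<in> topspace Y \<and> kmap Y x = p" if p: "p \<in> frame_hom (opn Y) two" for p
  proof -
    let ?C = "topspace Y - \<Union>{a \<in> opens Y. \<not> p a}"
    note C = point_imp_irreducible_closed[OF p]
    have closed: "closedin Y ?C"
      using C(1) unfolding irreducible_closed_def by (rule conjunct1)
    have p_eq: "(\<lambda>a\<in>opens Y. a \<inter> ?C \<noteq> {}) = p"
    proof
      fix a
      show "(\<lambda>a\<in>opens Y. a \<inter> ?C \<noteq> {}) a = p a"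
      proof (cases "a \<in> opens Y")
        case True
        then have "openin Y a"
          by (simp add: opens_def)
        show ?thesis
          unfolding restrict_apply'[OF True] C(2)[OF \<open>openin Y a\<close>] ..
      next
        case False
        then show ?thesis
          using p by (simp add: in_frame_hom_opn_two extensional_def)
      qed
    qed
    have "\<exists>!x. x \<in> topspace Y \<and> Y closure_of {x} = ?C"
      using sober C(1) unfolding sober_def by blast
    moreover have "Y closure_of {x} = ?C \<longleftrightarrow> kmap Y x = p" if "x \<in> topspace Y" for x
      using closure_of_singleton_eq_closed_iff[OF closed that] by (simp only: p_eq)
    ultimately show ?thesis
      by (simp only: cong: conj_cong)
  qed
  then have ex1: "\<exists>!x. x \<in> topspace Y \<and> kmap Y x = p" if "p \<in> frame_hom (opn Y) two" for p
    using that by blast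
  show "bij_betw (kmap Y) (topspace Y) (frame_hom (opn Y) two)"
  proof (rule bij_betw_imageI[OF inj_onI subset_antisym])
    fix x y
    assume "x \<in> topspace Y" "y \<in> topspace Y" "kmap Y x = kmap Y y"
    then show "x = y"
      using ex1[OF kmap_in_frame_hom] by metis
  next
    show "kmap Y ` topspace Y \<subseteq> frame_hom (opn Y) two"
      by (intro image_subsetI kmap_in_frame_hom)
    show "frame_hom (opn Y) two \<subseteq> kmap Y ` topspace Y"
      using ex1 by blast
  qed
next
  assume bij: "bij_betw (kmap Y) (topspace Y) (frame_hom (opn Y) two)"
  show "sober Y"
    unfolding sober_def
  proof (intro allI impI)
    fix C
    assume C: "irreducible_closed Y C"
    then have closed: "closedin Y C"
      unfolding irreducible_closed_def by (rule conjunct1)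
    have "(\<lambda>a\<in>opens Y. a \<inter> C \<noteq> {}) \<in> kmap Y ` topspace Y"
      unfolding bij_betw_imp_surj_on[OF bij] by (rule irreducible_closed_imp_point[OF C])
    then obtain x where x: "x \<in> topspace Y" "kmap Y x = (\<lambda>a\<in>opens Y. a \<inter> C \<noteq> {})"
      by force
    have "y = x" if "y \<in> topspace Y" "kmap Y y = (\<lambda>a\<in>opens Y. a \<inter> C \<noteq> {})" for y
      using that x inj_onD[OF bij_betw_imp_inj_on[OF bij], of y x] by simp
    then show "\<exists>!x. x \<in> topspace Y \<and> Y closure_of {x} = C"
      using x closure_of_singleton_eq_closed_iff[OF closed] by blast
  qed
qed

text \<open>The T0 half of sobriety, that is, injectivity of \<open>kmap\<close>; it lets an
  equation between points of \<open>T Z\<close> be tested on opens.\<close>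

lemma sober_open_ext:
  assumes "sober Y" "x \<in> topspace Y" "y \<in> topspace Y" "\<And>W. openin Y W \<Longrightarrow> x \<in> W \<longleftrightarrow> y \<in> W"
  shows "x = y"
proof -
  have "kmap Y x = kmap Y y"
    using assms(4) by (auto simp: kmap_def opens_def restrict_def)
  then show ?thesis
    using assms(1-3) by (auto simp: sober_iff_bij_betw_kmap bij_betw_def inj_on_def)
qed

section \<open>The topology on the points of a frame and its sobriety\<close>

text \<open>Closure of the carrier under the operations makes the sets \<open>tilde F a\<close>
  closed under binary intersections and unions, so that they are a topology.\<close>

definition closed_ops :: "'a frame_ops \<Rightarrow> bool" where
  "closed_ops F \<longleftrightarrow> ftop F \<in> fcarrier F \<and>
     (\<forall>a\<in>fcarrier F. \<forall>b\<in>fcarrier F. fmeet F a b \<in> fcarrier F) \<and>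
     (\<forall>A\<subseteq>fcarrier F. fjoin F A \<in> fcarrier F)"

lemma tilde_top: "tilde F (ftop F) = frame_hom F two"
  by (auto simp: tilde_def in_frame_hom_two)

lemma tilde_meet:
  "a \<in> fcarrier F \<Longrightarrow> b \<in> fcarrier F \<Longrightarrow> tilde F (fmeet F a b) = tilde F a \<inter> tilde F b"
  by (auto simp: tilde_def in_frame_hom_two)

lemma tilde_join: "A \<subseteq> fcarrier F \<Longrightarrow> tilde F (fjoin F A) = \<Union>(tilde F ` A)"
  by (auto simp: tilde_def in_frame_hom_two)

lemma openin_pt:
  assumes "closed_ops F"
  shows "openin (pt F) W \<longleftrightarrow> (\<exists>a\<in>fcarrier F. W = tilde F a)"
proof -
  have "istopology (\<lambda>W. \<exists>a\<in>fcarrier F. W = tilde F a)"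
    unfolding istopology_def
  proof (intro conjI allI impI)
    fix S R
    assume "\<exists>a\<in>fcarrier F. S = tilde F a" "\<exists>a\<in>fcarrier F. R = tilde F a"
    then obtain a b where "a \<in> fcarrier F" "b \<in> fcarrier F" "S = tilde F a" "R = tilde F b"
      by blast
    then show "\<exists>a\<in>fcarrier F. S \<inter> R = tilde F a"
      using assms unfolding closed_ops_def by (metis tilde_meet)
  next
    fix \<K>
    assume K: "\<forall>K\<in>\<K>. \<exists>a\<in>fcarrier F. K = tilde F a"
    \<comment> \<open>Taking all representatives of all members of \<K> avoids choosing one for
      each.\<close>
    let ?A = "{a \<in> fcarrier F. tilde F a \<in> \<K>}"
    have "K \<in> tilde F ` ?A" if "K \<in> \<K>" for K
      using bspec[OF K that] that by fast
    then have "tilde F ` ?A = \<K>"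
      by auto
    then have "\<Union>\<K> = tilde F (fjoin F ?A)"
      by (subst tilde_join) auto
    moreover have "fjoin F ?A \<in> fcarrier F"
      using assms by (simp add: closed_ops_def)
    ultimately show "\<exists>a\<in>fcarrier F. \<Union>\<K> = tilde F a"
      by blast
  qed
  then show ?thesis
    by (simp add: pt_def topology_inverse')
qed

lemma topspace_pt:
  assumes "closed_ops F"
  shows "topspace (pt F) = frame_hom F two"
proof
  show "topspace (pt F) \<subseteq> frame_hom F two"
    using openin_pt[OF assms, of "topspace (pt F)"] by (auto simp: tilde_def)
  show "frame_hom F two \<subseteq> topspace (pt F)"
  proof -
    have "openin (pt F) (tilde F (ftop F))"
      using openin_pt[OF assms] assms unfolding closed_ops_def by blast
    then show ?thesis
      by (simp only: tilde_top openin_subset)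
  qed
qed

text \<open>A point \<open>p\<close> of \<open>opn Y\<close> is pulled back along the map from
  elements of \<open>F\<close> to opens of \<open>Y\<close>. The result \<open>q\<close> is a point
  of \<open>F\<close>, and \<open>h q\<close> is the state of \<open>Y\<close> that
  \<open>kmap\<close> sends to \<open>p\<close>. Injectivity of \<open>kmap\<close> holds because
  points of \<open>F\<close> are separated by elements of \<open>F\<close>.\<close>

lemma sober_homeomorphic_pt:
  assumes F: "closed_ops F" and h: "homeomorphic_map (pt F) Y h"
  shows "sober Y"
proof -
  have inj: "inj_on h (frame_hom F two)" and top_Y: "topspace Y = h ` frame_hom F two"
    using homeomorphic_imp_injective_map[OF h] homeomorphic_imp_surjective_map[OF h]
    unfolding topspace_pt[OF F] by auto
  have sub: "tilde F a \<subseteq> frame_hom F two" for a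
    by (auto simp: tilde_def)
  have open_tilde: "openin Y (h ` tilde F a)" if "a \<in> fcarrier F" for a
    using homeomorphic_imp_open_map[OF h] that openin_pt[OF F] by (auto simp: open_map_def)
  have mem: "h q \<in> h ` tilde F a \<longleftrightarrow> q a" if "q \<in> frame_hom F two" for q a
    using that inj sub[of a] by (auto simp: inj_on_image_mem_iff) (auto simp: tilde_def)
  have open_Y: "\<exists>a\<in>fcarrier F. W = h ` tilde F a" if "openin Y W" for W
  proof -
    have "openin (pt F) {x \<in> topspace (pt F). h x \<in> W}"
      using h that by (simp add: homeomorphic_map_def quotient_map_def openin_subset)
    then obtain a where "a \<in> fcarrier F" "{x \<in> topspace (pt F). h x \<in> W} = tilde F a"
      using openin_pt[OF F] by auto
    moreover have "W = h ` {x \<in> topspace (pt F). h x \<in> W}"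
      using openin_subset[OF that] by (auto simp: top_Y topspace_pt[OF F])
    ultimately show ?thesis
      by auto
  qed
  show ?thesis
    unfolding sober_iff_bij_betw_kmap
  proof (rule bij_betw_imageI)
    show "inj_on (kmap Y) (topspace Y)"
    proof (rule inj_onI)
      fix x y
      assume "x \<in> topspace Y" "y \<in> topspace Y" and eq: "kmap Y x = kmap Y y"
      then obtain q r where qr: "q \<in> frame_hom F two" "r \<in> frame_hom F two" "x = h q" "y = h r"
        by (auto simp: top_Y)
      have "q a \<longleftrightarrow> r a" if "a \<in> fcarrier F" for a
      proof -
        have "x \<in> h ` tilde F a \<longleftrightarrow> y \<in> h ` tilde F a"
          using fun_cong[OF eq, of "h ` tilde F a"] open_tilde[OF that]
          by (simp add: kmap_def opens_def)
        then show ?thesis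
          using qr mem by simp
      qed
      then have "q = r"
        using qr by (intro extensionalityI[where A = "fcarrier F"]) (auto simp: in_frame_hom_two)
      then show "x = y"
        by (simp add: qr)
    qed
    show "kmap Y ` topspace Y = frame_hom (opn Y) two"
    proof
      show "kmap Y ` topspace Y \<subseteq> frame_hom (opn Y) two"
        by (intro image_subsetI kmap_in_frame_hom)
      show "frame_hom (opn Y) two \<subseteq> kmap Y ` topspace Y"
      proof
        fix p
        assume "p \<in> frame_hom (opn Y) two"
        then have p: "p \<in> extensional (opens Y)" "p (topspace Y)"
          "\<And>a b. openin Y a \<Longrightarrow> openin Y b \<Longrightarrow> p (a \<inter> b) \<longleftrightarrow> p a \<and> p b"
          "\<And>A. (\<And>a. a \<in> A \<Longrightarrow> openin Y a) \<Longrightarrow> p (\<Union>A) \<longleftrightarrow> (\<exists>a\<in>A. p a)"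
          by (auto simp: in_frame_hom_opn_two opens_def subset_iff)
        define q where "q = (\<lambda>a\<in>fcarrier F. p (h ` tilde F a))"
        \<comment> \<open>Images under \<open>h\<close> commute with intersections only by
          injectivity; this gives the meet condition for \<open>q\<close>.\<close>
        have "h ` (tilde F a \<inter> tilde F b) = h ` tilde F a \<inter> h ` tilde F b" for a b
          using inj sub by (metis inj_on_image_Int)
        moreover have "p (\<Union>a\<in>A. h ` tilde F a) \<longleftrightarrow> (\<exists>a\<in>A. p (h ` tilde F a))"
          if "A \<subseteq> fcarrier F" for A
          using p(4)[of "(\<lambda>a. h ` tilde F a) ` A"] open_tilde that by auto
        ultimately have q: "q \<in> frame_hom F two"
          unfolding in_frame_hom_two
          using F p(3)[OF open_tilde open_tilde] p(2)
          by (auto simp: q_def closed_ops_def tilde_top tilde_meet tilde_join image_UN top_Y subset_iff)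
        have "kmap Y (h q) W \<longleftrightarrow> p W" if "openin Y W" for W
        proof -
          obtain a where a: "a \<in> fcarrier F" "W = h ` tilde F a"
            using open_Y \<open>openin Y W\<close> by blast
          then have "h q \<in> W \<longleftrightarrow> p W"
            using mem[OF q] by (simp add: q_def)
          then show ?thesis
            using that by (simp add: kmap_def opens_def)
        qed
        then have "kmap Y (h q) = p"
          using p(1) by (intro extensionalityI[where A = "opens Y"]) (auto simp: kmap_def opens_def)
        then show "p \<in> kmap Y ` topspace Y"
          using q by (auto simp: top_Y)
      qed
    qed
  qed
qed

lemma pt_map_in_frame_hom:
  assumes d: "d \<in> frame_hom F G" and p: "p \<in> frame_hom G two" and F: "closed_ops F"
  shows "pt_map F d p \<in> frame_hom F two"
proof -
  have d_in: "a \<in> fcarrier F \<Longrightarrow> d a \<in> fcarrier G" for a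
    using d by (auto simp: frame_hom_def)
  have "p (d (fjoin F A)) \<longleftrightarrow> (\<exists>a\<in>A. p (d a))" if "A \<subseteq> fcarrier F" for A
  proof -
    have "d ` A \<subseteq> fcarrier G"
      using d_in that by blast
    then have "p (fjoin G (d ` A)) \<longleftrightarrow> (\<exists>c\<in>d ` A. p c)"
      using p unfolding in_frame_hom_two by blast
    moreover have "d (fjoin F A) = fjoin G (d ` A)"
      using d that by (simp add: frame_hom_def)
    ultimately show ?thesis
      by auto
  qed
  moreover have "d (ftop F) = ftop G"
    "\<And>a b. a \<in> fcarrier F \<Longrightarrow> b \<in> fcarrier F \<Longrightarrow> d (fmeet F a b) = fmeet G (d a) (d b)"
    using d by (auto simp: frame_hom_def)
  ultimately show ?thesis
    using F p d_in
    by (simp add: in_frame_hom_two pt_map_def closed_ops_def compose_def subset_iff)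
qed

lemma closed_ops_opn: "closed_ops (opn X)"
  by (auto simp: closed_ops_def opn_def opens_def)

lemma fcarrier_opn: "fcarrier (opn X) = opens X"
  by (simp add: opn_def)

text \<open>Extends a property from the liftings, which form a subbase of \<open>T Z\<close>, to all
  opens. It serves both to find the values of \<open>delta\<close> and to show that
  \<open>delta\<close> is unique.\<close>

lemma subbase_of_induct:
  assumes S: "subbase_of S Y" and W: "openin Y W"
    and top: "P (topspace Y)"
    and base: "\<And>a. a \<in> S \<Longrightarrow> P a"
    and Int: "\<And>a b. openin Y a \<Longrightarrow> openin Y b \<Longrightarrow> P a \<Longrightarrow> P b \<Longrightarrow> P (a \<inter> b)"
    and Union: "\<And>K. (\<And>a. a \<in> K \<Longrightarrow> openin Y a \<and> P a) \<Longrightarrow> P (\<Union>K)"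
    and sub: "\<And>a. a \<in> S \<Longrightarrow> a \<subseteq> topspace Y"
  shows "P W"
proof -
  have openin_Y: "openin Y = (arbitrary union_of (finite intersection_of (\<lambda>a. a \<in> S) relative_to topspace Y))"
    using topology_inverse'[OF istopology_subbase] S[unfolded subbase_of_def] by (rule subst[rotated])
  have open_base: "openin Y a" if "a \<in> S" for a
  proof -
    have "(finite intersection_of (\<lambda>a. a \<in> S) relative_to topspace Y) a"
      using that sub by (metis finite_intersection_of_inc relative_to_subset_inc)
    then show ?thesis
      unfolding openin_Y by (rule arbitrary_union_of_inc)
  qed
  \<comment> \<open>Intersecting with \<open>topspace Y\<close> makes the empty family yield the
    whole space, which is where \<open>top\<close> enters.\<close>
  have Inter: "openin Y (topspace Y \<inter> \<Inter>\<F>) \<and> P (topspace Y \<inter> \<Inter>\<F>)" if "finite \<F>" "\<F> \<subseteq> S" for \<F>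
    using that
  proof (induction \<F> rule: finite_induct)
    case empty
    then show ?case
      by (simp add: top)
  next
    case (insert a \<F>)
    then have "topspace Y \<inter> \<Inter>(insert a \<F>) = a \<inter> (topspace Y \<inter> \<Inter>\<F>)"
      by auto
    then show ?case
      using insert open_base base sub by (simp add: Int openin_Int)
  qed
  have basic: "openin Y B \<and> P B" if "(finite intersection_of (\<lambda>a. a \<in> S) relative_to topspace Y) B" for B
    using that Inter by (auto simp: relative_to_def intersection_of_def subset_iff)
  obtain K where "W = \<Union>K" "\<And>B. B \<in> K \<Longrightarrow> (finite intersection_of (\<lambda>a. a \<in> S) relative_to topspace Y) B"
    using W unfolding openin_Y by (auto simp: union_of_def arbitrary_def)
  then show ?thesis
    using basic Union by blast
qed

section \<open>Finitary formulas\<close>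

text \<open>The index set must consist of elements of \<open>'u\<close>, whence the embedding \<open>e\<close> of the naturals, which
  exists as soon as \<open>'u\<close> is infinite.\<close>

definition fin_disj :: "('u, 'p) formula list \<Rightarrow> ('u, 'p) formula" where
  "fin_disj \<phi>s =
     (let e = (SOME e. inj (e :: nat \<Rightarrow> 'u))
      in Disj (e ` {..<length \<phi>s}) (\<lambda>u. \<phi>s ! inv e u))"

text \<open>Disjunctions range over finite lists, so each member is a finite tree and can be coded
  by a word. The empty list is allowed and supplies falsum.\<close>

inductive_set finitary :: "'u lifting set \<Rightarrow> 'p set \<Rightarrow> ('u, 'p) formula set"
  for \<Lambda> :: "'u lifting set" and \<Phi> :: "'p set" where
  Truth: "Truth \<in> finitary \<Lambda> \<Phi>"
| Letter: "p \<in> \<Phi> \<Longrightarrow> Letter p \<in> finitary \<Lambda> \<Phi>"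
| Conj: "\<phi> \<in> finitary \<Lambda> \<Phi> \<Longrightarrow> \<psi> \<in> finitary \<Lambda> \<Phi> \<Longrightarrow> Conj \<phi> \<psi> \<in> finitary \<Lambda> \<Phi>"
| fin_disj: "(\<And>\<phi>. \<phi> \<in> set \<phi>s \<Longrightarrow> \<phi> \<in> finitary \<Lambda> \<Phi>) \<Longrightarrow> fin_disj \<phi>s \<in> finitary \<Lambda> \<Phi>"
| Heart: "l \<in> \<Lambda> \<Longrightarrow> length \<phi>s = arity l \<Longrightarrow> (\<And>\<phi>. \<phi> \<in> set \<phi>s \<Longrightarrow> \<phi> \<in> finitary \<Lambda> \<Phi>)
    \<Longrightarrow> Heart l \<phi>s \<in> finitary \<Lambda> \<Phi>"

text \<open>Finitary formulas are the results of running postfix programs on a stack, so there are no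
  more of them than words over the instructions.\<close>

fun exec :: "nat + 'u lifting + 'p \<Rightarrow> ('u, 'p) formula list \<Rightarrow> ('u, 'p) formula list" where
  "exec (Inl 0) st = Truth # st"
| "exec (Inl (Suc 0)) st = Conj (st ! 0) (st ! 1) # drop 2 st"
| "exec (Inl (Suc (Suc n))) st = fin_disj (take n st) # drop n st"
| "exec (Inr (Inl l)) st = Heart l (take (arity l) st) # drop (arity l) st"
| "exec (Inr (Inr p)) st = Letter p # st"

text \<open>Quantifying over the initial stack \<open>st\<close> makes the induction compositional:
  the program of a subformula leaves the results already on the stack intact.\<close>

lemma finitary_program:
  assumes "\<phi> \<in> finitary \<Lambda> \<Phi>"
  shows "\<exists>ts\<in>lists (UNIV <+> (\<Lambda> <+> \<Phi>)). \<forall>st. fold exec ts st = \<phi> # st"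
proof -
  let ?W = "lists (UNIV <+> (\<Lambda> <+> \<Phi>))"
  have many: "\<exists>ts\<in>?W. \<forall>st. fold exec ts st = \<phi>s @ st"
    if "\<And>\<phi>. \<phi> \<in> set \<phi>s \<Longrightarrow> \<exists>ts\<in>?W. \<forall>st. fold exec ts st = \<phi> # st" for \<phi>s
    using that
  proof (induction \<phi>s)
    case Nil
    then show ?case
      by (intro bexI[of _ "[]"]) auto
  next
    case (Cons \<phi> \<phi>s)
    obtain us where "us \<in> ?W" "\<forall>st. fold exec us st = \<phi> # st"
      using Cons.prems[of \<phi>] by auto
    moreover obtain ts where "ts \<in> ?W" "\<forall>st. fold exec ts st = \<phi>s @ st"
      using Cons.IH Cons.prems by auto
    \<comment> \<open>In \<open>ts @ us\<close> the program for the tail runs first, so that the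
      head of the list ends on top of the stack.\<close>
    ultimately show ?case
      by (intro bexI[of _ "ts @ us"]) auto
  qed
  show ?thesis
    using assms
  proof induction
    case Truth
    then show ?case
      by (intro bexI[of _ "[Inl 0]"]) auto
  next
    case (Letter p)
    then show ?case
      by (intro bexI[of _ "[Inr (Inr p)]"]) auto
  next
    case (Conj \<phi> \<psi>)
    obtain ts where "ts \<in> ?W" "\<forall>st. fold exec ts st = [\<phi>, \<psi>] @ st"
      using many[of "[\<phi>, \<psi>]"] Conj by auto
    then show ?case
      by (intro bexI[of _ "ts @ [Inl 1]"]) auto
  next
    case (fin_disj \<phi>s)
    obtain ts where "ts \<in> ?W" "\<forall>st. fold exec ts st = \<phi>s @ st"
      using many[of \<phi>s] fin_disj by auto
    then show ?case
      \<comment> \<open>The codes 0 and 1 belong to \<open>Truth\<close> and \<open>Conj\<close>, so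
        a disjunction of length n has code n + 2.\<close>
      by (intro bexI[of _ "ts @ [Inl (Suc (Suc (length \<phi>s)))]"]) auto
  next
    case (Heart l \<phi>s)
    obtain ts where "ts \<in> ?W" "\<forall>st. fold exec ts st = \<phi>s @ st"
      using many[of \<phi>s] Heart by auto
    then show ?case
      using Heart by (intro bexI[of _ "ts @ [Inr (Inl l)]"]) auto
  qed
qed

lemma finitary_lepoll: "finitary \<Lambda> \<Phi> \<lesssim> (UNIV :: nat set) <+> (\<Lambda> <+> \<Phi>)"
proof -
  let ?K = "(UNIV :: nat set) <+> (\<Lambda> <+> \<Phi>)"
  have "finitary \<Lambda> \<Phi> \<subseteq> (\<lambda>ts. hd (fold exec ts [])) ` lists ?K"
  proof
    fix \<phi>
    assume "\<phi> \<in> finitary \<Lambda> \<Phi>"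
    from finitary_program[OF this] obtain ts where "ts \<in> lists ?K" "fold exec ts [] = [\<phi>]"
      by blast
    then show "\<phi> \<in> (\<lambda>ts. hd (fold exec ts [])) ` lists ?K"
      by (intro image_eqI[of _ _ ts]) simp_all
  qed
  then have "finitary \<Lambda> \<Phi> \<lesssim> lists ?K"
    by (rule subset_image_lepoll)
  also have "\<dots> \<lesssim> ?K"
    by (intro lepoll_lists_infinite) (simp add: finite_Plus_iff)
  finally show ?thesis .
qed

section \<open>The standing assumptions, and finitary formulas as members of the language\<close>

text \<open>The assumption \<open>size\<close> is what makes \<open>E\<close> and
  \<open>pt E\<close> small: both embed into the powerset of the finitary formulas, whose number is
  bounded by that of the naturals, liftings and letters together.\<close>

locale geometric_signature =
  fixes \<U> :: "'u set set"
    and T :: "'u endofun"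
    and \<Lambda> :: "'u lifting set"
    and \<Phi> :: "'p set"
  assumes universe: "universe \<U>"
    and size: "\<exists>A\<in>\<U>. Pow ((UNIV :: nat set) <+> (\<Lambda> <+> \<Phi>)) \<lesssim> A"
    and endofunctor: "endofunctor \<U> T"
    and preserves_sobriety: "preserves_sobriety \<U> T"
    and modal_signature: "modal_signature \<U> T \<Lambda>"
    and scott_continuous: "scott_continuous \<U> \<Lambda>"
    and characteristic: "characteristic \<U> T \<Lambda>"
begin

abbreviation "Mods \<equiv> Mod_ob \<U> T \<Phi>"
abbreviation "L \<equiv> GML \<U> \<Lambda> \<Phi>"
abbreviation "cls \<equiv> fclass \<U> T \<Lambda> \<Phi>"
abbreviation "E \<equiv> EE \<U> T \<Lambda> \<Phi>"
abbreviation "Fin \<equiv> finitary \<Lambda> \<Phi>"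

lemma small: "A \<in> \<U> \<Longrightarrow> B \<lesssim> A \<Longrightarrow> B \<in> \<U>"
  using universe by (auto simp: universe_def)

text \<open>\<open>A\<close> is infinite because it dominates the powerset of an infinite set. Its
  infinity provides the index sets of finite disjunctions.\<close>

lemma Pow_Fin_bound:
  obtains A where "A \<in> \<U>" "infinite A" "Pow Fin \<lesssim> A"
proof -
  let ?K = "(UNIV :: nat set) <+> (\<Lambda> <+> \<Phi>)"
  obtain A where A: "A \<in> \<U>" "Pow ?K \<lesssim> A"
    using size by blast
  obtain g where "inj_on g Fin" "g ` Fin \<subseteq> ?K"
    using finitary_lepoll unfolding lepoll_def by blast
  then have "Pow Fin \<lesssim> Pow ?K"
    unfolding lepoll_def by (intro exI[of _ "image g"]) (auto simp: inj_on_image_Pow)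
  then have "Pow Fin \<lesssim> A"
    using A(2) lepoll_trans by blast
  moreover have "infinite A"
  proof
    assume "finite A"
    obtain f where "inj_on f (Pow ?K)" "f ` Pow ?K \<subseteq> A"
      using A(2) unfolding lepoll_def by blast
    from inj_on_finite[OF this \<open>finite A\<close>] have "finite (Pow ?K)" .
    then show False
      unfolding finite_Pow_iff finite_Plus_iff by simp
  qed
  ultimately show thesis
    using that A(1) by blast
qed

lemma finite_small: "finite (B :: 'u set) \<Longrightarrow> B \<in> \<U>"
  by (rule Pow_Fin_bound) (blast intro: small finite_lepoll_infinite)

text \<open>Justifies the choice made in \<open>fin_disj\<close>: positions in the list can be
  recovered from the indices.\<close>

lemma inj_index: "inj (SOME e. inj (e :: nat \<Rightarrow> 'u))"
proof -
  obtain A :: "'u set" where "infinite A"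
    using Pow_Fin_bound by blast
  then have "\<exists>e. inj (e :: nat \<Rightarrow> 'u)"
    using infinite_le_lepoll[of A] by (auto simp: lepoll_def)
  then show ?thesis
    by (rule someI_ex)
qed

lemma fin_disj_in_GML:
  assumes "\<And>\<phi>. \<phi> \<in> set \<phi>s \<Longrightarrow> \<phi> \<in> L"
  shows "fin_disj \<phi>s \<in> L"
  unfolding fin_disj_def Let_def using assms inj_index
  by (intro GML.intros finite_small) auto

lemma sem_fin_disj: "sem M (fin_disj (\<phi>s :: ('u, 'p) formula list)) = \<Union>(sem M ` set \<phi>s)"
  using inj_index by (auto simp: fin_disj_def Let_def set_conv_nth)

lemma finitary_imp_GML: "\<phi> \<in> Fin \<Longrightarrow> \<phi> \<in> L"
  by (induction rule: finitary.induct) (auto intro: GML.intros fin_disj_in_GML)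

section \<open>Monotonicity and Scott-continuity of liftings in all arguments together\<close>

lemma arr_in_top_hom:
  "X \<in> Top \<U> \<Longrightarrow> Y \<in> Top \<U> \<Longrightarrow> f \<in> top_hom X Y \<Longrightarrow> arr T X Y f \<in> top_hom (obj T X) (obj T Y)"
  using endofunctor by (simp add: endofunctor_def)

lemma openin_lift:
  "l \<in> \<Lambda> \<Longrightarrow> X \<in> Top \<U> \<Longrightarrow> as \<in> open_tuples X (arity l) \<Longrightarrow> openin (obj T X) (lift l X as)"
  using modal_signature by (simp add: modal_signature_def open_predicate_lifting_def opens_def)

lemma lift_natural:
  "l \<in> \<Lambda> \<Longrightarrow> X \<in> Top \<U> \<Longrightarrow> Y \<in> Top \<U> \<Longrightarrow> f \<in> top_hom X Y \<Longrightarrow> as \<in> open_tuples Y (arity l) \<Longrightarrow>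
     lift l X (map (inv_img X f) as) = inv_img (obj T X) (arr T X Y f) (lift l Y as)"
  using modal_signature by (simp add: modal_signature_def open_predicate_lifting_def)

lemma lift_directed_Union:
  "l \<in> \<Lambda> \<Longrightarrow> X \<in> Top \<U> \<Longrightarrow> as \<in> open_tuples X (arity l) \<Longrightarrow> i < arity l \<Longrightarrow> A \<subseteq> opens X \<Longrightarrow> directed A
    \<Longrightarrow> lift l X (as[i := \<Union>A]) = (\<Union>b\<in>A. lift l X (as[i := b]))"
  using scott_continuous by (simp add: scott_continuous_def)

text \<open>Scott-continuity for the directed pair \<open>{a, b}\<close>, whose union is
  \<open>b\<close>.\<close>

lemma lift_update_mono:
  assumes "l \<in> \<Lambda>" "X \<in> Top \<U>" "as \<in> open_tuples X (arity l)" "i < arity l"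
    and "a \<in> opens X" "b \<in> opens X" "a \<subseteq> b"
  shows "lift l X (as[i := a]) \<subseteq> lift l X (as[i := b])"
proof -
  have "directed {a, b}"
    using assms by (auto simp: directed_def)
  then have "lift l X (as[i := \<Union>{a, b}]) = (\<Union>c\<in>{a, b}. lift l X (as[i := c]))"
    using assms by (intro lift_directed_Union) auto
  moreover have "\<Union>{a, b} = b"
    using assms by blast
  ultimately show ?thesis
    by auto
qed

lemma open_tuples_update:
  "as \<in> open_tuples X n \<Longrightarrow> a \<in> opens X \<Longrightarrow> as[i := a] \<in> open_tuples X n"
  using set_update_subset_insert[of as i a] by (auto simp: open_tuples_def)

text \<open>The arguments are exchanged one at a time from the left;
  \<open>take k bs @ drop k as\<close> is the tuple after \<open>k\<close> exchanges.\<close>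

lemma lift_mono:
  assumes l: "l \<in> \<Lambda>" and X: "X \<in> Top \<U>"
    and as: "as \<in> open_tuples X (arity l)" and bs: "bs \<in> open_tuples X (arity l)"
    and le: "\<And>i. i < arity l \<Longrightarrow> as ! i \<subseteq> bs ! i"
  shows "lift l X as \<subseteq> lift l X bs"
proof -
  have len: "length as = arity l" "length bs = arity l"
    using as bs by (auto simp: open_tuples_def)
  have "lift l X as \<subseteq> lift l X (take k bs @ drop k as)" if "k \<le> arity l" for k
    using that
  proof (induction k)
    case (Suc k)
    let ?cs = "take k bs @ drop k as"
    have "set ?cs \<subseteq> opens X"
      using as bs by (auto simp: open_tuples_def dest: in_set_takeD in_set_dropD)
    then have cs: "?cs \<in> open_tuples X (arity l)"
      using len Suc.prems by (simp add: open_tuples_def)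
    have "?cs ! k = as ! k"
      using len Suc.prems by (simp add: nth_append)
    then have "?cs[k := as ! k] = ?cs"
      by (metis list_update_id)
    moreover have "?cs[k := bs ! k] = take (Suc k) bs @ drop (Suc k) as"
      using len Suc.prems by (simp add: list_update_append take_Suc_conv_app_nth Cons_nth_drop_Suc[symmetric])
    moreover have "lift l X (?cs[k := as ! k]) \<subseteq> lift l X (?cs[k := bs ! k])"
      using as bs len Suc.prems le by (intro lift_update_mono[OF l X cs]) (auto simp: open_tuples_def)
    ultimately show ?case
      using Suc by auto
  qed simp
  from this[of "arity l"] show ?thesis
    using len by simp
qed

text \<open>Scott-continuity treats a single argument, so the unions are replaced by members
  position by position. The invariant says that positions below \<open>k\<close> already hold
  members and the others still hold full unions.\<close>

lemma lift_directed_choice: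
  assumes l: "l \<in> \<Lambda>" and X: "X \<in> Top \<U>"
    and D: "\<And>i. i < arity l \<Longrightarrow> D i \<subseteq> opens X \<and> directed (D i)"
    and t: "t \<in> lift l X (map (\<lambda>i. \<Union>(D i)) [0..<arity l])"
  obtains bs where "bs \<in> open_tuples X (arity l)" "\<And>i. i < arity l \<Longrightarrow> bs ! i \<in> D i" "t \<in> lift l X bs"
proof -
  have Union: "\<Union>(D i) \<in> opens X" if "i < arity l" for i
    using D[OF that] by (auto simp: opens_def)
  have "\<exists>bs\<in>open_tuples X (arity l). (\<forall>i<k. bs ! i \<in> D i) \<and>
      (\<forall>i<arity l. k \<le> i \<longrightarrow> bs ! i = \<Union>(D i)) \<and> t \<in> lift l X bs" if "k \<le> arity l" for k
    using that
  proof (induction k)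
    case 0
    show ?case
      using t Union
      by (intro bexI[of _ "map (\<lambda>i. \<Union>(D i)) [0..<arity l]"]) (auto simp: open_tuples_def)
  next
    case (Suc k)
    then obtain bs where bs: "bs \<in> open_tuples X (arity l)" "\<And>i. i < k \<Longrightarrow> bs ! i \<in> D i"
      "\<And>i. i < arity l \<Longrightarrow> k \<le> i \<Longrightarrow> bs ! i = \<Union>(D i)" "t \<in> lift l X bs"
      by auto
    have k: "k < arity l" and len: "length bs = arity l"
      using Suc.prems bs(1) by (auto simp: open_tuples_def)
    \<comment> \<open>Writes the tuple as an update at \<open>k\<close>, the shape to which
      Scott-continuity applies.\<close>
    have "bs[k := \<Union>(D k)] = bs"
      using bs(3)[OF k] by (metis list_update_id order_refl)
    then have "t \<in> (\<Union>b\<in>D k. lift l X (bs[k := b]))"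
      using lift_directed_Union[OF l X bs(1) k, of "D k"] D[OF k] bs(4) by simp
    then obtain b where b: "b \<in> D k" "t \<in> lift l X (bs[k := b])"
      by blast
    then have "bs[k := b] \<in> open_tuples X (arity l)"
      using D[OF k] by (intro open_tuples_update bs) auto
    then show ?case
      using b bs(2,3) len k
      by (intro bexI[of _ "bs[k := b]"]) (auto simp: nth_list_update less_Suc_eq)
  qed
  from this[of "arity l"] show thesis
    using that by auto
qed

section \<open>Truth sets and their approximation by finitary formulas\<close>

lemma ModsD:
  assumes "M \<in> Mods"
  shows "state_space M \<in> Top \<U>"
    and "structure_map M \<in> top_hom (state_space M) (obj T (state_space M))"
    and "p \<in> \<Phi> \<Longrightarrow> openin (state_space M) (valuation M p)"
  using assms by (auto simp: Mod_ob_def opens_def PiE_def Pi_def)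

lemma openin_inv_img: "f \<in> top_hom X Y \<Longrightarrow> openin Y a \<Longrightarrow> openin X (inv_img X f a)"
  unfolding top_hom_def inv_img_def by (auto intro: openin_continuous_map_preimage)

lemma openin_sem:
  assumes "\<phi> \<in> L" "M \<in> Mods"
  shows "openin (state_space M) (sem M \<phi>)"
  using assms(1)
proof induction
  case (5 l \<phi>s)
  then have "map (sem M) \<phi>s \<in> open_tuples (state_space M) (arity l)"
    by (auto simp: open_tuples_def opens_def)
  then show ?case
    using 5 ModsD[OF assms(2)] by (auto intro!: openin_inv_img openin_lift)
qed (use ModsD[OF assms(2)] in auto)

lemma open_tuples_sem:
  "M \<in> Mods \<Longrightarrow> set \<phi>s \<subseteq> L \<Longrightarrow> length \<phi>s = n \<Longrightarrow> map (sem M) \<phi>s \<in> open_tuples (state_space M) n"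
  using openin_sem by (auto simp: open_tuples_def opens_def)

text \<open>The finitary approximants of \<phi>. Entailment is required in all models, so this set
  depends on the class of \<phi> alone and can serve as a code for it.\<close>

definition below :: "('u, 'p) formula \<Rightarrow> ('u, 'p) formula set" where
  "below \<phi> = {\<psi> \<in> Fin. \<forall>M\<in>Mods. sem M \<psi> \<subseteq> sem M \<phi>}"

text \<open>Finitary formulas admit finite disjunctions: the empty one gives nonemptiness, the
  binary one gives upper bounds.\<close>

lemma directed_below:
  assumes "M \<in> Mods"
  shows "directed (sem M ` below \<phi>)"
  unfolding directed_def
proof (intro conjI ballI)
  have "fin_disj [] \<in> below \<phi>"
    by (auto simp: below_def sem_fin_disj intro: finitary.intros)
  then show "sem M ` below \<phi> \<noteq> {}"
    by blast
  fix a b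
  assume "a \<in> sem M ` below \<phi>" "b \<in> sem M ` below \<phi>"
  then obtain \<psi> \<chi> where *: "\<psi> \<in> below \<phi>" "a = sem M \<psi>" "\<chi> \<in> below \<phi>" "b = sem M \<chi>"
    by blast
  then have "fin_disj [\<psi>, \<chi>] \<in> below \<phi>"
    by (auto simp: below_def sem_fin_disj intro!: finitary.intros)
  then have "sem M (fin_disj [\<psi>, \<chi>]) \<in> sem M ` below \<phi>"
    by (rule imageI)
  then show "\<exists>c\<in>sem M ` below \<phi>. a \<subseteq> c \<and> b \<subseteq> c"
    by (rule rev_bexI) (simp add: * sem_fin_disj)
qed

lemma below_GML: "\<psi> \<in> below \<phi> \<Longrightarrow> \<psi> \<in> L"
  by (simp add: below_def finitary_imp_GML)

text \<open>Induction on \<phi>. In the modal case the arguments are directed unions of truth sets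
  of approximants, so by Scott-continuity a state of the lifted set already lies in the lift of one
  tuple of approximants.\<close>

lemma sem_eq_Union_below:
  assumes "\<phi> \<in> L" "M \<in> Mods"
  shows "sem M \<phi> = \<Union>(sem M ` below \<phi>)"
proof
  show "\<Union>(sem M ` below \<phi>) \<subseteq> sem M \<phi>"
    using assms(2) by (auto simp: below_def)
  show "sem M \<phi> \<subseteq> \<Union>(sem M ` below \<phi>)"
    using assms(1)
  proof induction
    case 1
    have "Truth \<in> below Truth"
      by (simp add: below_def finitary.intros)
    then show ?case
      by blast
  next
    case (2 p)
    then have "Letter p \<in> below (Letter p)"
      by (simp add: below_def finitary.intros)
    then show ?case
      by blast
  next
    case (3 \<phi> \<psi>)
    show ?case
    proof
      fix x
      assume "x \<in> sem M (Conj \<phi> \<psi>)"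
      then have "x \<in> \<Union>(sem M ` below \<phi>)" "x \<in> \<Union>(sem M ` below \<psi>)"
        using 3 by auto
      then obtain \<phi>' \<psi>' where "\<phi>' \<in> below \<phi>" "x \<in> sem M \<phi>'" "\<psi>' \<in> below \<psi>" "x \<in> sem M \<psi>'"
        by blast
      moreover from this have "Conj \<phi>' \<psi>' \<in> below (Conj \<phi> \<psi>)"
        by (auto simp: below_def intro: finitary.intros)
      ultimately show "x \<in> \<Union>(sem M ` below (Conj \<phi> \<psi>))"
        by (intro UN_I[of "Conj \<phi>' \<psi>'"]) auto
    qed
  next
    case (4 I f)
    have "below (f i) \<subseteq> below (Disj I f)" if "i \<in> I" for i
      using that by (auto simp: below_def)
    then show ?case
      using 4 by fastforce
  next
    case (5 l \<phi>s)
    let ?X = "state_space M"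
    have set_L: "set \<phi>s \<subseteq> L"
      using 5 by auto
    show ?case
    proof
      fix x
      assume x: "x \<in> sem M (Heart l \<phi>s)"
      define D where "D i = sem M ` below (\<phi>s ! i)" for i
      have D: "D i \<subseteq> opens ?X \<and> directed (D i)" for i
        using directed_below[OF assms(2)] openin_sem[OF below_GML assms(2)]
        by (auto simp: D_def opens_def)
      have "sem M (\<phi>s ! i) = \<Union>(D i)" if "i < arity l" for i
        using 5 that assms(2) unfolding D_def by (intro subset_antisym) (auto simp: below_def)
      then have "map (sem M) \<phi>s = map (\<lambda>i. \<Union>(D i)) [0..<arity l]"
        using 5 by (intro nth_equalityI) auto
      then have "structure_map M x \<in> lift l ?X (map (\<lambda>i. \<Union>(D i)) [0..<arity l])"
        using x by (simp add: inv_img_def)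
      from lift_directed_choice[OF \<open>l \<in> \<Lambda>\<close> ModsD(1)[OF assms(2)], of D, OF D this]
      obtain bs where bs: "bs \<in> open_tuples ?X (arity l)" "\<And>i. i < arity l \<Longrightarrow> bs ! i \<in> D i"
        "structure_map M x \<in> lift l ?X bs"
        by blast
      \<comment> \<open>The sets found live in \<open>M\<close>; naming them by formulas allows
        passing to other models.\<close>
      have "\<forall>i<arity l. \<exists>\<psi>. \<psi> \<in> below (\<phi>s ! i) \<and> bs ! i = sem M \<psi>"
        using bs(2) by (auto simp: D_def)
      then obtain g where g: "\<And>i. i < arity l \<Longrightarrow> g i \<in> below (\<phi>s ! i)"
        "\<And>i. i < arity l \<Longrightarrow> bs ! i = sem M (g i)"
        by metis
      define \<psi>s where "\<psi>s = map g [0..<arity l]"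
      have \<psi>s: "length \<psi>s = arity l" "set \<psi>s \<subseteq> Fin"
        using g(1) by (auto simp: \<psi>s_def below_def)
      then have "set \<psi>s \<subseteq> L"
        using finitary_imp_GML by blast
      have "map (sem M) \<psi>s = bs"
        using bs(1) g(2) by (intro nth_equalityI) (auto simp: \<psi>s_def open_tuples_def)
      then have "x \<in> sem M (Heart l \<psi>s)"
        using bs(3) x by (simp add: inv_img_def)
      \<comment> \<open>Membership in \<open>below\<close> demands entailment in every model, hence
        monotonicity is used in an arbitrary \<open>N\<close>.\<close>
      moreover have "sem N (Heart l \<psi>s) \<subseteq> sem N (Heart l \<phi>s)" if N: "N \<in> Mods" for N
      proof -
        have "lift l (state_space N) (map (sem N) \<psi>s) \<subseteq> lift l (state_space N) (map (sem N) \<phi>s)"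
        proof (rule lift_mono[OF \<open>l \<in> \<Lambda>\<close> ModsD(1)[OF N]])
          show "map (sem N) \<psi>s \<in> open_tuples (state_space N) (arity l)"
            using \<psi>s \<open>set \<psi>s \<subseteq> L\<close> by (intro open_tuples_sem N)
          show "map (sem N) \<phi>s \<in> open_tuples (state_space N) (arity l)"
            using 5(2) set_L by (intro open_tuples_sem N)
          show "map (sem N) \<psi>s ! i \<subseteq> map (sem N) \<phi>s ! i" if "i < arity l" for i
            using g(1)[OF that] 5(2) N that by (simp add: \<psi>s_def below_def)
        qed
        then show ?thesis
          by (auto simp: inv_img_def)
      qed
      moreover have "Heart l \<psi>s \<in> Fin"
        using \<psi>s \<open>l \<in> \<Lambda>\<close> by (intro finitary.intros) auto
      ultimately show "x \<in> \<Union>(sem M ` below (Heart l \<phi>s))"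
        unfolding below_def by blast
    qed
  qed
qed

section \<open>The frame of formulas and its points\<close>

text \<open>All members of a class have the same truth set, so the union is that common set and no
  representative has to be chosen.\<close>

definition csem :: "('u, 'p) gmodel \<Rightarrow> ('u, 'p) formula set \<Rightarrow> 'u set" where
  "csem M c = \<Union>(sem M ` c)"

lemma fcarrier_E: "fcarrier E = cls ` L"
  by (simp add: EE_def)

lemma cls_in_carrier: "\<phi> \<in> L \<Longrightarrow> cls \<phi> \<in> fcarrier E"
  by (simp add: fcarrier_E)

lemma equivalent_iff_sem_eq:
  assumes "\<phi> \<in> L" "\<psi> \<in> L"
  shows "equivalent \<U> T \<Phi> \<phi> \<psi> \<longleftrightarrow> (\<forall>M\<in>Mods. sem M \<phi> = sem M \<psi>)"
proof -
  have "sem M \<phi> \<subseteq> topspace (state_space M)" "sem M \<psi> \<subseteq> topspace (state_space M)" if "M \<in> Mods" for M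
    using openin_sem[OF assms(1) that] openin_sem[OF assms(2) that] by (auto dest: openin_subset)
  then show ?thesis
    unfolding equivalent_def by blast
qed

lemma csem_cls:
  assumes "\<phi> \<in> L" "M \<in> Mods"
  shows "csem M (cls \<phi>) = sem M \<phi>"
proof -
  have "\<phi> \<in> cls \<phi>"
    using assms by (simp add: fclass_def equivalent_def)
  moreover have "sem M \<psi> = sem M \<phi>" if "\<psi> \<in> cls \<phi>" for \<psi>
    using that assms equivalent_iff_sem_eq[OF assms(1)] by (auto simp: fclass_def)
  ultimately show ?thesis
    unfolding csem_def by blast
qed

lemma cls_eqI:
  assumes "\<phi> \<in> L" "\<psi> \<in> L" "\<And>M. M \<in> Mods \<Longrightarrow> sem M \<phi> = sem M \<psi>"
  shows "cls \<phi> = cls \<psi>"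
  using assms by (auto simp: fclass_def equivalent_iff_sem_eq)

text \<open>Truth sets in all models separate the elements of \<open>E\<close>; equations in
  \<open>E\<close>, such as the homomorphism laws of \<open>delta\<close>, are proved through
  this.\<close>

lemma csem_ext:
  assumes "c \<in> fcarrier E" "d \<in> fcarrier E" "\<And>M. M \<in> Mods \<Longrightarrow> csem M c = csem M d"
  shows "c = d"
proof -
  obtain \<phi> \<psi> where *: "\<phi> \<in> L" "c = cls \<phi>" "\<psi> \<in> L" "d = cls \<psi>"
    using assms(1,2) by (auto simp: fcarrier_E)
  show ?thesis
    unfolding *(2,4)
  proof (rule cls_eqI[OF *(1,3)])
    show "sem M \<phi> = sem M \<psi>" if "M \<in> Mods" for M
      using assms(3)[OF that] * that by (simp add: csem_cls)
  qed
qed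

text \<open>On the class of \<phi> the map \<open>?g\<close> is \<open>below \<phi>\<close>, from
  which all truth sets of \<phi> are recovered as unions.\<close>

lemma carrier_lepoll: "fcarrier E \<lesssim> Pow Fin"
proof -
  let ?g = "\<lambda>c. {\<psi> \<in> Fin. \<forall>M\<in>Mods. sem M \<psi> \<subseteq> csem M c}"
  have below: "?g (cls \<phi>) = below \<phi>" if "\<phi> \<in> L" for \<phi>
    using that by (auto simp: below_def csem_cls)
  have "inj_on ?g (fcarrier E)"
  proof (rule inj_onI)
    fix c d
    assume "c \<in> fcarrier E" "d \<in> fcarrier E" and eq: "?g c = ?g d"
    then obtain \<phi> \<psi> where *: "\<phi> \<in> L" "c = cls \<phi>" "\<psi> \<in> L" "d = cls \<psi>"
      by (auto simp: fcarrier_E)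
    then have "below \<phi> = below \<psi>"
      using eq below by simp
    then show "c = d"
      unfolding *(2,4) by (intro cls_eqI * ) (simp_all add: sem_eq_Union_below *)
  qed
  then show ?thesis
    unfolding lepoll_def by (intro exI[of _ ?g]) auto
qed

lemma Disj_GML_iff: "Disj I f \<in> L \<longleftrightarrow> I \<in> \<U> \<and> (\<forall>i\<in>I. f i \<in> L)"
  by (auto intro: GML.intros elim: GML.cases)

text \<open>Because the carrier is small, any subset of it can be indexed by a member of \<U>, so
  its join is the class of a single formula.\<close>

lemma Disj_exists:
  assumes "S \<subseteq> fcarrier E"
  obtains I f where "Disj I f \<in> L" "S = (\<lambda>i. cls (f i)) ` I"
proof -
  obtain A :: "'u set" where A: "A \<in> \<U>" "Pow Fin \<lesssim> A"
    using Pow_Fin_bound by blast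
  have "S \<lesssim> A"
    using subset_imp_lepoll[OF assms] carrier_lepoll A(2) lepoll_trans by blast
  then obtain g where g: "inj_on g S" "g ` S \<subseteq> A"
    by (auto simp: lepoll_def)
  have "\<forall>c\<in>S. \<exists>\<phi>. \<phi> \<in> L \<and> cls \<phi> = c"
    using assms by (auto simp: fcarrier_E)
  then obtain r where r: "\<And>c. c \<in> S \<Longrightarrow> r c \<in> L \<and> cls (r c) = c"
    by metis
  let ?f = "\<lambda>i. r (inv_into S g i)"
  have "g ` S \<in> \<U>"
    using small[OF A(1)] subset_imp_lepoll[OF g(2)] by blast
  then have "Disj (g ` S) ?f \<in> L"
    using r g(1) by (auto simp: Disj_GML_iff)
  moreover have "S = (\<lambda>i. cls (?f i)) ` g ` S"
    using r g(1) by (simp add: image_image)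
  ultimately show thesis
    using that by blast
qed

lemma sem_Disj_csem:
  assumes "Disj I f \<in> L" "M \<in> Mods"
  shows "sem M (Disj I f) = \<Union>(csem M ` (\<lambda>i. cls (f i)) ` I)"
  using assms by (auto simp: csem_cls Disj_GML_iff)

text \<open>Shows that the description in \<open>fjoin\<close> is well defined: two families with
  the same classes have disjunctions with the same truth sets. \<open>fmeet_cls\<close> does the
  same for meets.\<close>

lemma fjoin_cls:
  assumes "Disj I f \<in> L"
  shows "fjoin E ((\<lambda>i. cls (f i)) ` I) = cls (Disj I f)"
proof -
  have "(THE c. \<exists>J g. Disj J g \<in> L \<and> (\<lambda>i. cls (f i)) ` I = (\<lambda>i. cls (g i)) ` J \<and> c = cls (Disj J g))
      = cls (Disj I f)"
  proof (rule the_equality)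
    fix c
    assume "\<exists>J g. Disj J g \<in> L \<and> (\<lambda>i. cls (f i)) ` I = (\<lambda>i. cls (g i)) ` J \<and> c = cls (Disj J g)"
    then obtain J g where Jg: "Disj J g \<in> L" "(\<lambda>i. cls (f i)) ` I = (\<lambda>i. cls (g i)) ` J" "c = cls (Disj J g)"
      by blast
    have "sem M (Disj J g) = sem M (Disj I f)" if "M \<in> Mods" for M
      using sem_Disj_csem[OF assms that] sem_Disj_csem[OF Jg(1) that] Jg(2) by simp
    then show "c = cls (Disj I f)"
      unfolding Jg(3) by (intro cls_eqI Jg(1) assms)
  qed (use assms in blast)
  then show ?thesis
    by (simp add: EE_def)
qed

lemma fmeet_cls:
  assumes "\<phi> \<in> L" "\<psi> \<in> L"
  shows "fmeet E (cls \<phi>) (cls \<psi>) = cls (Conj \<phi> \<psi>)"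
proof -
  have "(THE c. \<exists>\<phi>'\<in>L. \<exists>\<psi>'\<in>L. cls \<phi> = cls \<phi>' \<and> cls \<psi> = cls \<psi>' \<and> c = cls (Conj \<phi>' \<psi>'))
      = cls (Conj \<phi> \<psi>)"
  proof (rule the_equality)
    fix c
    assume "\<exists>\<phi>'\<in>L. \<exists>\<psi>'\<in>L. cls \<phi> = cls \<phi>' \<and> cls \<psi> = cls \<psi>' \<and> c = cls (Conj \<phi>' \<psi>')"
    then obtain \<phi>' \<psi>' where *: "\<phi>' \<in> L" "\<psi>' \<in> L" "cls \<phi> = cls \<phi>'" "cls \<psi> = cls \<psi>'" "c = cls (Conj \<phi>' \<psi>')"
      by blast
    have "sem M (Conj \<phi>' \<psi>') = sem M (Conj \<phi> \<psi>)" if "M \<in> Mods" for M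
    proof -
      have "sem M \<phi>' = sem M \<phi>" "sem M \<psi>' = sem M \<psi>"
        using * assms that by (metis csem_cls)+
      then show ?thesis
        by simp
    qed
    then show "c = cls (Conj \<phi> \<psi>)"
      unfolding *(5) by (intro cls_eqI GML.intros * assms)
  qed (use assms in blast)
  then show ?thesis
    by (simp add: EE_def)
qed

lemma ftop_E: "ftop E = cls Truth"
  by (simp add: EE_def)

lemma closed_ops_E: "closed_ops E"
proof -
  have "fjoin E S \<in> fcarrier E" if "S \<subseteq> fcarrier E" for S
    using Disj_exists[OF that] fjoin_cls cls_in_carrier by metis
  then show ?thesis
    by (auto simp: closed_ops_def ftop_E fcarrier_E fmeet_cls intro: GML.intros)
qed

lemma csem_top: "M \<in> Mods \<Longrightarrow> csem M (ftop E) = topspace (state_space M)"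
  by (simp add: ftop_E csem_cls GML.intros)

lemma csem_meet:
  "c \<in> fcarrier E \<Longrightarrow> d \<in> fcarrier E \<Longrightarrow> M \<in> Mods \<Longrightarrow> csem M (fmeet E c d) = csem M c \<inter> csem M d"
  by (auto simp: fcarrier_E fmeet_cls csem_cls GML.intros)

lemma csem_join:
  assumes "S \<subseteq> fcarrier E" "M \<in> Mods"
  shows "csem M (fjoin E S) = \<Union>(csem M ` S)"
proof -
  obtain I f where If: "Disj I f \<in> L" "S = (\<lambda>i. cls (f i)) ` I"
    using Disj_exists[OF assms(1)] .
  show ?thesis
    unfolding If(2) fjoin_cls[OF If(1)] csem_cls[OF If(1) assms(2)] sem_Disj_csem[OF If(1) assms(2)] ..
qed

text \<open>Carries the approximation from truth sets over to \<open>E\<close> itself, where points,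
  which preserve joins, can make use of it.\<close>

lemma cls_eq_join_below:
  assumes "\<phi> \<in> L"
  shows "cls \<phi> = fjoin E (cls ` below \<phi>)"
proof -
  have sub: "cls ` below \<phi> \<subseteq> fcarrier E"
    using below_GML cls_in_carrier by blast
  show ?thesis
  proof (rule csem_ext)
    show "cls \<phi> \<in> fcarrier E"
      using assms by (rule cls_in_carrier)
    show "fjoin E (cls ` below \<phi>) \<in> fcarrier E"
      using closed_ops_E sub by (simp add: closed_ops_def)
    fix M
    assume M: "M \<in> Mods"
    have "csem M (fjoin E (cls ` below \<phi>)) = \<Union>(csem M ` cls ` below \<phi>)"
      by (rule csem_join[OF sub M])
    also have "\<dots> = \<Union>(sem M ` below \<phi>)"
      using csem_cls[OF below_GML M] by simp
    also have "\<dots> = csem M (cls \<phi>)"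
      using assms M by (simp add: csem_cls sem_eq_Union_below[symmetric])
    finally show "csem M (cls \<phi>) = csem M (fjoin E (cls ` below \<phi>))" ..
  qed
qed

text \<open>A point preserves the join of approximants, so its value on any class is determined by
  the finitary formulas it accepts.\<close>

lemma points_lepoll: "frame_hom E two \<lesssim> Pow Fin"
proof -
  let ?g = "\<lambda>p. {\<psi> \<in> Fin. p (cls \<psi>)}"
  have determined: "p (cls \<phi>) \<longleftrightarrow> ?g p \<inter> below \<phi> \<noteq> {}" if "p \<in> frame_hom E two" "\<phi> \<in> L" for p \<phi>
  proof -
    have "cls ` below \<phi> \<subseteq> fcarrier E"
      using below_GML cls_in_carrier by blast
    then have "p (fjoin E (cls ` below \<phi>)) \<longleftrightarrow> (\<exists>c\<in>cls ` below \<phi>. p c)"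
      using that(1) unfolding in_frame_hom_two by blast
    then have "p (cls \<phi>) \<longleftrightarrow> (\<exists>\<psi>\<in>below \<phi>. p (cls \<psi>))"
      unfolding cls_eq_join_below[OF that(2), symmetric] by blast
    then show ?thesis
      unfolding below_def by blast
  qed
  have "inj_on ?g (frame_hom E two)"
  proof (rule inj_onI)
    fix p q
    assume p: "p \<in> frame_hom E two" and q: "q \<in> frame_hom E two" and eq: "?g p = ?g q"
    have "p c = q c" if "c \<in> fcarrier E" for c
      using that determined[OF p] determined[OF q] unfolding eq fcarrier_E by blast
    then show "p = q"
      using p q by (intro extensionalityI[of p "fcarrier E" q]) (simp_all add: in_frame_hom_two)
  qed
  then show ?thesis
    unfolding lepoll_def by (intro exI[of _ ?g]) auto
qed

lemma ex_homeomorphic_copy: "\<exists>Z h. Z \<in> Top \<U> \<and> homeomorphic_map (pt E) Z h"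
proof -
  obtain A :: "'u set" where A: "A \<in> \<U>" "Pow Fin \<lesssim> A"
    using Pow_Fin_bound by blast
  have "topspace (pt E) \<lesssim> A"
    unfolding topspace_pt[OF closed_ops_E] using points_lepoll A(2) lepoll_trans by blast
  then obtain Z :: "'u topology" and h where "topspace Z \<lesssim> A" "homeomorphic_map (pt E) Z h"
    by (rule lepoll_imp_homeomorphic_space)
  then show ?thesis
    using small[OF A(1)] by (auto simp: Top_def)
qed

lemma subbase_lift:
  "X \<in> Top \<U> \<Longrightarrow> subbase_of {lift l X as | l as. l \<in> \<Lambda> \<and> as \<in> open_tuples X (arity l)} (obj T X)"
  using characteristic by (simp add: characteristic_def)

text \<open>Induction on \<phi>; the modal case combines naturality of the lifting with the
  commuting square of the morphism.\<close>

lemma Mod_hom_sem: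
  assumes M: "M \<in> Mods" and N: "N \<in> Mods" and f: "f \<in> Mod_hom T \<Phi> M N" and "\<phi> \<in> L"
  shows "sem M \<phi> = inv_img (state_space M) f (sem N \<phi>)"
  using assms(4)
proof induction
  let ?X = "state_space M" and ?Y = "state_space N"
  have f_hom: "f \<in> top_hom ?X ?Y"
    using f by (simp add: Mod_hom_def)
  then have f_in: "x \<in> topspace ?X \<Longrightarrow> f x \<in> topspace ?Y" for x
    by (auto simp: top_hom_def continuous_map_def)
  {
    case 1
    then show ?case
      using f_in by (auto simp: inv_img_def)
  next
    case (2 p)
    then show ?case
      using f by (simp add: Mod_hom_def)
  next
    case (3 \<phi> \<psi>)
    then show ?case
      by (auto simp: inv_img_def)
  next
    case (4 I g)
    then show ?case
      by (auto simp: inv_img_def)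
  next
    case (5 l \<phi>s)
    have "set \<phi>s \<subseteq> L"
      using 5 by blast
    then have tuple: "map (sem N) \<phi>s \<in> open_tuples ?Y (arity l)"
      using 5(2) by (intro open_tuples_sem N)
    have map_eq: "map (sem M) \<phi>s = map (inv_img ?X f) (map (sem N) \<phi>s)"
      using 5 by simp
    have lift: "lift l ?X (map (sem M) \<phi>s) =
        inv_img (obj T ?X) (arr T ?X ?Y f) (lift l ?Y (map (sem N) \<phi>s))"
      unfolding map_eq by (rule lift_natural[OF 5(1) ModsD(1)[OF M] ModsD(1)[OF N] f_hom tuple])
    have "compose (topspace ?X) (structure_map N) f x
        = compose (topspace ?X) (arr T ?X ?Y f) (structure_map M) x" for x
      using f by (simp add: Mod_hom_def)
    then have "structure_map N (f x) = arr T ?X ?Y f (structure_map M x)" if "x \<in> topspace ?X" for x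
      using that by (metis compose_eq)
    moreover have "structure_map M x \<in> topspace (obj T ?X)" if "x \<in> topspace ?X" for x
      using that ModsD(2)[OF M] by (auto simp: top_hom_def continuous_map_def)
    ultimately show ?case
      using f_in by (auto simp: lift inv_img_def)
  }
qed

end

section \<open>The final model\<close>

locale final_model = geometric_signature \<U> T \<Lambda> \<Phi>
  for \<U> :: "'u set set" and T :: "'u endofun" and \<Lambda> :: "'u lifting set" and \<Phi> :: "'p set" +
  fixes Z :: "'u topology" and h :: "(('u, 'p) formula set \<Rightarrow> bool) \<Rightarrow> 'u"
  assumes Z_in_Top: "Z \<in> Top \<U>" and homeomorphic: "homeomorphic_map (pt E) Z h"
begin

abbreviation "Zo \<equiv> Zopen \<U> T \<Lambda> \<Phi> h"
abbreviation "TZ \<equiv> obj T Z"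
abbreviation "\<ZZ> \<equiv> ZZ \<U> T \<Lambda> \<Phi> Z h"
abbreviation "\<zeta> \<equiv> zeta \<U> T \<Lambda> \<Phi> Z h"

lemma inj_h: "inj_on h (frame_hom E two)"
  using homeomorphic_imp_injective_map[OF homeomorphic] unfolding topspace_pt[OF closed_ops_E] .

lemma topspace_Z: "topspace Z = h ` frame_hom E two"
  using homeomorphic_imp_surjective_map[OF homeomorphic] unfolding topspace_pt[OF closed_ops_E] ..

section \<open>The states and opens of \<open>Z\<close> in terms of formulas\<close>

definition point :: "'u \<Rightarrow> ('u, 'p) formula set \<Rightarrow> bool" where
  "point z = inv_into (topspace (pt E)) h z"

lemma point_h: "q \<in> frame_hom E two \<Longrightarrow> point (h q) = q"
  unfolding point_def topspace_pt[OF closed_ops_E] by (rule inv_into_f_f[OF inj_h])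

lemma point_in_frame_hom: "z \<in> topspace Z \<Longrightarrow> point z \<in> frame_hom E two"
  unfolding topspace_Z by (auto simp: point_h)

lemma h_point: "z \<in> topspace Z \<Longrightarrow> h (point z) = z"
  unfolding topspace_Z by (auto simp: point_h)

lemma mem_Zopen: "z \<in> Zo \<phi> \<longleftrightarrow> z \<in> topspace Z \<and> point z (cls \<phi>)"
proof
  assume "z \<in> Zo \<phi>"
  then obtain q where "q \<in> frame_hom E two" "q (cls \<phi>)" "z = h q"
    by (auto simp: Zopen_def tilde_def)
  then show "z \<in> topspace Z \<and> point z (cls \<phi>)"
    by (simp add: point_h topspace_Z)
next
  assume z: "z \<in> topspace Z \<and> point z (cls \<phi>)"
  then have "h (point z) \<in> Zo \<phi>"
    unfolding Zopen_def tilde_def by (intro imageI) (simp add: point_in_frame_hom)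
  then show "z \<in> Zo \<phi>"
    using z by (simp add: h_point)
qed

lemma openin_Zopen:
  assumes "\<phi> \<in> L"
  shows "openin Z (Zo \<phi>)"
proof -
  have "openin (pt E) (tilde E (cls \<phi>))"
    using assms cls_in_carrier openin_pt[OF closed_ops_E] by blast
  then show ?thesis
    using homeomorphic_imp_open_map[OF homeomorphic] by (simp add: Zopen_def open_map_def)
qed

text \<open>Every open, not merely a basic one, has this form, because the opens of
  \<open>pt E\<close> are exactly the sets \<open>tilde E c\<close> and every \<open>c\<close> is
  the class of a formula.\<close>

lemma openin_Z_imp_Zopen:
  assumes "openin Z W"
  obtains \<phi> where "\<phi> \<in> L" "W = Zo \<phi>"
proof -
  let ?V = "{q \<in> frame_hom E two. h q \<in> W}"
  have "openin (pt E) {q \<in> topspace (pt E). h q \<in> W}"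
    using homeomorphic_imp_continuous_map[OF homeomorphic] assms
    by (rule openin_continuous_map_preimage)
  then have "openin (pt E) ?V"
    unfolding topspace_pt[OF closed_ops_E] .
  then obtain \<phi> where \<phi>: "\<phi> \<in> L" "?V = tilde E (cls \<phi>)"
    unfolding openin_pt[OF closed_ops_E] fcarrier_E by blast
  have "W = h ` ?V"
    using openin_subset[OF assms] by (auto simp: topspace_Z)
  then show thesis
    using that \<phi> by (simp add: Zopen_def)
qed

lemma Z_ext:
  assumes "y \<in> topspace Z" "z \<in> topspace Z" "\<And>\<phi>. \<phi> \<in> L \<Longrightarrow> y \<in> Zo \<phi> \<longleftrightarrow> z \<in> Zo \<phi>"
  shows "y = z"
proof -
  have "point y c = point z c" if "c \<in> fcarrier E" for c
    using that assms by (auto simp: fcarrier_E mem_Zopen)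
  then have "point y = point z"
    using point_in_frame_hom[OF assms(1)] point_in_frame_hom[OF assms(2)]
    by (intro extensionalityI[of _ "fcarrier E"]) (simp_all add: in_frame_hom_two)
  then show ?thesis
    using assms h_point by metis
qed

lemma sober_TZ: "sober TZ"
  using preserves_sobriety Z_in_Top sober_homeomorphic_pt[OF closed_ops_E homeomorphic]
  by (simp add: preserves_sobriety_def)

text \<open>Hence every subbasic open of \<open>T Z\<close> is one of the generators on which
  \<open>delta\<close> is prescribed.\<close>

lemma open_tuples_Z:
  assumes "as \<in> open_tuples Z n"
  obtains \<phi>s where "length \<phi>s = n" "set \<phi>s \<subseteq> L" "as = map Zo \<phi>s"
proof -
  have "\<exists>\<phi>. \<phi> \<in> L \<and> Zo \<phi> = a" if "a \<in> set as" for a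
  proof -
    have "openin Z a"
      using assms that by (auto simp: open_tuples_def opens_def)
    then show ?thesis
      by (rule openin_Z_imp_Zopen) blast
  qed
  then obtain r where r: "\<And>a. a \<in> set as \<Longrightarrow> r a \<in> L \<and> Zo (r a) = a"
    by metis
  then have "as = map Zo (map r as)"
    by (simp add: map_idI)
  moreover have "length (map r as) = n" "set (map r as) \<subseteq> L"
    using assms r by (auto simp: open_tuples_def)
  ultimately show thesis
    using that by blast
qed

lemma Zopen_open_tuples: "set \<phi>s \<subseteq> L \<Longrightarrow> map Zo \<phi>s \<in> open_tuples Z (length \<phi>s)"
  using openin_Zopen by (auto simp: open_tuples_def opens_def)

section \<open>The theory map and the pullback of opens of \<open>T Z\<close> along it\<close>

text \<open>The inner restriction makes the theory an element of \<open>frame_hom E two\<close>, the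
  outer one makes the map an element of \<open>top_hom\<close>; both consist of extensional
  functions.\<close>

definition theory_map :: "('u, 'p) gmodel \<Rightarrow> 'u \<Rightarrow> 'u" where
  "theory_map M = (\<lambda>x\<in>topspace (state_space M). h (\<lambda>c\<in>fcarrier E. x \<in> csem M c))"

lemma satisfied_in_frame_hom:
  assumes "M \<in> Mods" "x \<in> topspace (state_space M)"
  shows "(\<lambda>c\<in>fcarrier E. x \<in> csem M c) \<in> frame_hom E two"
  using closed_ops_E assms
  by (auto simp: in_frame_hom_two closed_ops_def csem_top csem_meet csem_join subset_iff)

lemma theory_map_in_topspace: "M \<in> Mods \<Longrightarrow> x \<in> topspace (state_space M) \<Longrightarrow> theory_map M x \<in> topspace Z"
  by (simp add: theory_map_def topspace_Z satisfied_in_frame_hom)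

lemma point_theory_map:
  "M \<in> Mods \<Longrightarrow> x \<in> topspace (state_space M) \<Longrightarrow> c \<in> fcarrier E \<Longrightarrow> point (theory_map M x) c \<longleftrightarrow> x \<in> csem M c"
  by (simp add: theory_map_def point_h satisfied_in_frame_hom)

text \<open>Since all opens of \<open>Z\<close> are of the form \<open>Zo \<phi>\<close>, this
  yields continuity of the theory map; for letters it yields compatibility with valuations.\<close>

lemma inv_img_theory_map:
  assumes "M \<in> Mods" "\<phi> \<in> L"
  shows "inv_img (state_space M) (theory_map M) (Zo \<phi>) = sem M \<phi>"
proof -
  have "sem M \<phi> \<subseteq> topspace (state_space M)"
    using openin_sem[OF assms(2,1)] by (rule openin_subset)
  then show ?thesis
    using assms by (auto simp: inv_img_def mem_Zopen theory_map_in_topspace point_theory_map cls_in_carrier csem_cls)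
qed

lemma theory_map_in_top_hom:
  assumes "M \<in> Mods"
  shows "theory_map M \<in> top_hom (state_space M) Z"
proof -
  have "openin (state_space M) {x \<in> topspace (state_space M). theory_map M x \<in> W}" if W: "openin Z W" for W
  proof -
    obtain \<phi> where "\<phi> \<in> L" "W = Zo \<phi>"
      using openin_Z_imp_Zopen[OF W] .
    then show ?thesis
      using openin_sem inv_img_theory_map assms unfolding inv_img_def by metis
  qed
  moreover have "theory_map M \<in> topspace (state_space M) \<rightarrow> topspace Z"
    using theory_map_in_topspace[OF assms] by blast
  ultimately have "continuous_map (state_space M) Z (theory_map M)"
    unfolding continuous_map_def by blast
  then show ?thesis
    by (simp add: top_hom_def theory_map_def)
qed

text \<open>The preimage of \<open>W\<close> along one leg of the square that a morphism into
  \<open>Z\<close> must satisfy; the other leg will give the truth set of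
  \<open>\<delta> W\<close>.\<close>

definition pull :: "('u, 'p) gmodel \<Rightarrow> 'u set \<Rightarrow> 'u set" where
  "pull M W = {x \<in> topspace (state_space M). arr T (state_space M) Z (theory_map M) (structure_map M x) \<in> W}"

lemma arr_theory_map_in_TZ:
  assumes "M \<in> Mods" "x \<in> topspace (state_space M)"
  shows "structure_map M x \<in> topspace (obj T (state_space M))"
    and "arr T (state_space M) Z (theory_map M) (structure_map M x) \<in> topspace TZ"
proof -
  show 1: "structure_map M x \<in> topspace (obj T (state_space M))"
    using ModsD(2)[OF assms(1)] assms(2) by (auto simp: top_hom_def continuous_map_def)
  show "arr T (state_space M) Z (theory_map M) (structure_map M x) \<in> topspace TZ"
    using arr_in_top_hom[OF ModsD(1)[OF assms(1)] Z_in_Top theory_map_in_top_hom[OF assms(1)]] 1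
    by (auto simp: top_hom_def continuous_map_def)
qed

text \<open>Naturality of \<open>l\<close> at the theory map, which pulls \<open>Zo \<phi>\<close>
  back to the truth set of \<phi>.\<close>

lemma pull_lift:
  assumes l: "l \<in> \<Lambda>" and \<phi>s: "length \<phi>s = arity l" "set \<phi>s \<subseteq> L" and M: "M \<in> Mods"
  shows "pull M (lift l Z (map Zo \<phi>s)) = sem M (Heart l \<phi>s)"
proof -
  let ?X = "state_space M"
  have "map (inv_img ?X (theory_map M)) (map Zo \<phi>s) = map (sem M) \<phi>s"
    using inv_img_theory_map[OF M] \<phi>s(2) by (simp add: subset_iff)
  then have "lift l ?X (map (sem M) \<phi>s) = inv_img (obj T ?X) (arr T ?X Z (theory_map M)) (lift l Z (map Zo \<phi>s))"
    using lift_natural[OF l ModsD(1)[OF M] Z_in_Top theory_map_in_top_hom[OF M]] Zopen_open_tuples \<phi>s by metis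
  then show ?thesis
    using arr_theory_map_in_TZ(1)[OF M] by (auto simp: pull_def inv_img_def)
qed

text \<open>The class \<open>c\<close> is found before the model \<open>M\<close>; this uniformity
  is what allows \<open>c\<close> to be the value of \<open>delta\<close> at \<open>W\<close>. The
  proof is by induction over the subbase, as \<open>pull M\<close> commutes with intersections and
  unions.\<close>

lemma pull_definable:
  assumes "openin TZ W"
  shows "\<exists>c\<in>fcarrier E. \<forall>M\<in>Mods. csem M c = pull M W"
  using subbase_lift[OF Z_in_Top] assms
proof (rule subbase_of_induct)
  have "pull M (topspace TZ) = topspace (state_space M)" if "M \<in> Mods" for M
    using arr_theory_map_in_TZ(2)[OF that] by (auto simp: pull_def)
  then show "\<exists>c\<in>fcarrier E. \<forall>M\<in>Mods. csem M c = pull M (topspace TZ)"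
    using closed_ops_E by (intro bexI[of _ "ftop E"]) (simp_all add: csem_top closed_ops_def)
next
  fix a
  assume "a \<in> {lift l Z as | l as. l \<in> \<Lambda> \<and> as \<in> open_tuples Z (arity l)}"
  then obtain l as where a: "l \<in> \<Lambda>" "as \<in> open_tuples Z (arity l)" "a = lift l Z as"
    by blast
  then show "a \<subseteq> topspace TZ"
    using openin_lift[OF a(1) Z_in_Top a(2)] by (simp add: openin_subset)
  obtain \<phi>s where \<phi>s: "length \<phi>s = arity l" "set \<phi>s \<subseteq> L" "as = map Zo \<phi>s"
    using open_tuples_Z[OF a(2)] .
  have "Heart l \<phi>s \<in> L"
    using a(1) \<phi>s by (intro GML.intros) auto
  then show "\<exists>c\<in>fcarrier E. \<forall>M\<in>Mods. csem M c = pull M a"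
    using pull_lift[OF a(1) \<phi>s(1,2)]
    by (intro bexI[of _ "cls (Heart l \<phi>s)"]) (simp_all add: a(3) \<phi>s(3) csem_cls cls_in_carrier del: sem.simps)
next
  fix a b
  assume "\<exists>c\<in>fcarrier E. \<forall>M\<in>Mods. csem M c = pull M a" "\<exists>c\<in>fcarrier E. \<forall>M\<in>Mods. csem M c = pull M b"
  then obtain c d where cd: "c \<in> fcarrier E" "\<And>M. M \<in> Mods \<Longrightarrow> csem M c = pull M a"
    "d \<in> fcarrier E" "\<And>M. M \<in> Mods \<Longrightarrow> csem M d = pull M b"
    by blast
  have "pull M (a \<inter> b) = pull M a \<inter> pull M b" for M
    by (auto simp: pull_def)
  then show "\<exists>c\<in>fcarrier E. \<forall>M\<in>Mods. csem M c = pull M (a \<inter> b)"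
    using cd closed_ops_E by (intro bexI[of _ "fmeet E c d"]) (simp_all add: csem_meet closed_ops_def)
next
  fix K
  assume "\<And>a. a \<in> K \<Longrightarrow> openin TZ a \<and> (\<exists>c\<in>fcarrier E. \<forall>M\<in>Mods. csem M c = pull M a)"
  then have "\<forall>a\<in>K. \<exists>c. c \<in> fcarrier E \<and> (\<forall>M\<in>Mods. csem M c = pull M a)"
    by blast
  then obtain r where r: "\<And>a. a \<in> K \<Longrightarrow> r a \<in> fcarrier E"
    "\<And>a M. a \<in> K \<Longrightarrow> M \<in> Mods \<Longrightarrow> csem M (r a) = pull M a"
    by metis
  then have sub: "r ` K \<subseteq> fcarrier E"
    by blast
  have "csem M (fjoin E (r ` K)) = pull M (\<Union>K)" if "M \<in> Mods" for M
    unfolding csem_join[OF sub that] using r(2)[OF _ that] by (auto simp: pull_def)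
  then show "\<exists>c\<in>fcarrier E. \<forall>M\<in>Mods. csem M c = pull M (\<Union>K)"
    using closed_ops_E sub by (intro bexI[of _ "fjoin E (r ` K)"]) (simp_all add: closed_ops_def)
qed

section \<open>The frame homomorphism from the opens of \<open>T Z\<close> to the classes of
  formulas\<close>

abbreviation "\<delta> \<equiv> delta \<U> T \<Lambda> \<Phi> Z h"

text \<open>A candidate \<open>d\<close> picks for each open \<open>W\<close> a class with truth
  sets \<open>pull M W\<close>. Truth sets separate classes, so \<open>d\<close> inherits the
  homomorphism laws from \<open>pull\<close> and has the prescribed values on generators.\<close>

lemma delta_characterization:
  shows delta_in_frame_hom: "\<delta> \<in> frame_hom (opn TZ) E"
    and csem_delta: "\<And>W M. openin TZ W \<Longrightarrow> M \<in> Mods \<Longrightarrow> csem M (\<delta> W) = pull M W"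
    and delta_lift: "\<And>l \<phi>s. l \<in> \<Lambda> \<Longrightarrow> length \<phi>s = arity l \<Longrightarrow> set \<phi>s \<subseteq> L \<Longrightarrow>
      \<delta> (lift l Z (map Zo \<phi>s)) = cls (Heart l \<phi>s)"
proof -
  have "\<forall>W\<in>opens TZ. \<exists>c. c \<in> fcarrier E \<and> (\<forall>M\<in>Mods. csem M c = pull M W)"
    using pull_definable unfolding opens_def by blast
  then obtain g where g: "\<And>W. openin TZ W \<Longrightarrow> g W \<in> fcarrier E"
    "\<And>W M. openin TZ W \<Longrightarrow> M \<in> Mods \<Longrightarrow> csem M (g W) = pull M W"
    unfolding opens_def by (metis mem_Collect_eq)
  define d where "d = restrict g (opens TZ)"
  have d: "d W \<in> fcarrier E" "M \<in> Mods \<Longrightarrow> csem M (d W) = pull M W" if "openin TZ W" for W M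
    using g that by (simp_all add: d_def opens_def)
  have d_hom: "d \<in> frame_hom (opn TZ) E"
  proof -
    have "d (topspace TZ) = ftop E"
    proof (rule csem_ext)
      show "csem M (d (topspace TZ)) = csem M (ftop E)" if "M \<in> Mods" for M
        using that arr_theory_map_in_TZ(2)[OF that] by (auto simp: d csem_top pull_def)
    qed (use d closed_ops_E in \<open>auto simp: closed_ops_def\<close>)
    moreover have "d (a \<inter> b) = fmeet E (d a) (d b)" if "openin TZ a" "openin TZ b" for a b
    proof (rule csem_ext)
      show "csem M (d (a \<inter> b)) = csem M (fmeet E (d a) (d b))" if "M \<in> Mods" for M
        using that \<open>openin TZ a\<close> \<open>openin TZ b\<close> by (auto simp: d csem_meet openin_Int pull_def)
    qed (use d that closed_ops_E in \<open>auto simp: closed_ops_def\<close>)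
    moreover have "d (\<Union>A) = fjoin E (d ` A)" if A: "A \<subseteq> opens TZ" for A
    proof (rule csem_ext)
      have Un: "openin TZ (\<Union>A)" and mem: "\<And>a. a \<in> A \<Longrightarrow> openin TZ a"
        using A by (auto simp: opens_def)
      have sub: "d ` A \<subseteq> fcarrier E"
        using d(1) mem by blast
      show "d (\<Union>A) \<in> fcarrier E"
        using d(1) Un by blast
      show "fjoin E (d ` A) \<in> fcarrier E"
        using closed_ops_E sub by (simp add: closed_ops_def)
      show "csem M (d (\<Union>A)) = csem M (fjoin E (d ` A))" if M: "M \<in> Mods" for M
        unfolding csem_join[OF sub M] d(2)[OF Un M] using d(2)[OF mem M] by (auto simp: pull_def)
    qed
    moreover have "d \<in> opens TZ \<rightarrow>\<^sub>E fcarrier E"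
      using d(1) by (auto simp: d_def opens_def)
    ultimately show ?thesis
      by (auto simp: frame_hom_def opn_def opens_def subset_iff)
  qed
  have d_lift: "d (lift l Z (map Zo \<phi>s)) = cls (Heart l \<phi>s)"
    if l: "l \<in> \<Lambda>" and \<phi>s: "length \<phi>s = arity l" "set \<phi>s \<subseteq> L" for l \<phi>s
  proof (rule csem_ext)
    have "openin TZ (lift l Z (map Zo \<phi>s))"
      using openin_lift[OF l Z_in_Top] Zopen_open_tuples[OF \<phi>s(2)] \<phi>s(1) by simp
    moreover have "Heart l \<phi>s \<in> L"
      using l \<phi>s by (intro GML.intros) auto
    ultimately show "d (lift l Z (map Zo \<phi>s)) \<in> fcarrier E" "cls (Heart l \<phi>s) \<in> fcarrier E"
      "\<And>M. M \<in> Mods \<Longrightarrow> csem M (d (lift l Z (map Zo \<phi>s))) = csem M (cls (Heart l \<phi>s))"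
      using pull_lift[OF l \<phi>s] by (simp_all add: d csem_cls cls_in_carrier del: sem.simps)
  qed
  \<comment> \<open>The definite description needs uniqueness: homomorphisms that agree on the
    subbase agree on all opens.\<close>
  have "\<delta> = d"
    unfolding delta_def
  proof (rule the_equality)
    show "d \<in> frame_hom (opn TZ) E \<and> (\<forall>l\<in>\<Lambda>. \<forall>\<phi>s. length \<phi>s = arity l \<and> set \<phi>s \<subseteq> L \<longrightarrow>
        d (lift l Z (map Zo \<phi>s)) = cls (Heart l \<phi>s))"
      using d_hom d_lift by blast
  next
    fix d'
    assume "d' \<in> frame_hom (opn TZ) E \<and> (\<forall>l\<in>\<Lambda>. \<forall>\<phi>s. length \<phi>s = arity l \<and> set \<phi>s \<subseteq> L \<longrightarrow>
        d' (lift l Z (map Zo \<phi>s)) = cls (Heart l \<phi>s))"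
    then have d': "d' \<in> frame_hom (opn TZ) E"
      and d'_lift: "\<And>l \<phi>s. l \<in> \<Lambda> \<Longrightarrow> length \<phi>s = arity l \<Longrightarrow> set \<phi>s \<subseteq> L \<Longrightarrow>
        d' (lift l Z (map Zo \<phi>s)) = cls (Heart l \<phi>s)"
      by blast+
    have hom: "e (topspace TZ) = ftop E"
      "\<And>a b. openin TZ a \<Longrightarrow> openin TZ b \<Longrightarrow> e (a \<inter> b) = fmeet E (e a) (e b)"
      "\<And>K. K \<subseteq> opens TZ \<Longrightarrow> e (\<Union>K) = fjoin E (e ` K)" "e \<in> extensional (opens TZ)"
      if "e \<in> frame_hom (opn TZ) E" for e
      using that by (auto simp: frame_hom_def opn_def opens_def PiE_def)
    have "d' W = d W" if "openin TZ W" for W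
      using subbase_lift[OF Z_in_Top] that
    proof (rule subbase_of_induct)
      show "d' (topspace TZ) = d (topspace TZ)"
        using hom[OF d'] hom[OF d_hom] by simp
    next
      fix a
      assume "a \<in> {lift l Z as | l as. l \<in> \<Lambda> \<and> as \<in> open_tuples Z (arity l)}"
      then obtain l as where a: "l \<in> \<Lambda>" "as \<in> open_tuples Z (arity l)" "a = lift l Z as"
        by blast
      show "a \<subseteq> topspace TZ"
        using openin_lift[OF a(1) Z_in_Top a(2)] by (simp add: a(3) openin_subset)
      obtain \<phi>s where \<phi>s: "length \<phi>s = arity l" "set \<phi>s \<subseteq> L" "as = map Zo \<phi>s"
        using open_tuples_Z[OF a(2)] .
      show "d' a = d a"
        unfolding a(3) \<phi>s(3) d_lift[OF a(1) \<phi>s(1,2)] d'_lift[OF a(1) \<phi>s(1,2)] ..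
    next
      fix a b
      assume "openin TZ a" "openin TZ b" "d' a = d a" "d' b = d b"
      then show "d' (a \<inter> b) = d (a \<inter> b)"
        using hom(2)[OF d'] hom(2)[OF d_hom] by simp
    next
      fix K
      assume K: "\<And>a. a \<in> K \<Longrightarrow> openin TZ a \<and> d' a = d a"
      then have "K \<subseteq> opens TZ" "d' ` K = d ` K"
        by (auto simp: opens_def intro!: image_cong)
      then show "d' (\<Union>K) = d (\<Union>K)"
        using hom(3)[OF d'] hom(3)[OF d_hom] by simp
    qed
    then show "d' = d"
      using hom(4)[OF d'] hom(4)[OF d_hom]
      by (intro extensionalityI[of d' "opens TZ" d]) (simp_all add: opens_def)
  qed
  then show "\<delta> \<in> frame_hom (opn TZ) E"
    "\<And>W M. openin TZ W \<Longrightarrow> M \<in> Mods \<Longrightarrow> csem M (\<delta> W) = pull M W"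
    "\<And>l \<phi>s. l \<in> \<Lambda> \<Longrightarrow> length \<phi>s = arity l \<Longrightarrow> set \<phi>s \<subseteq> L \<Longrightarrow>
      \<delta> (lift l Z (map Zo \<phi>s)) = cls (Heart l \<phi>s)"
    using d_hom d(2) d_lift by blast+
qed

lemma delta_in_carrier: "openin TZ W \<Longrightarrow> \<delta> W \<in> fcarrier E"
  using delta_in_frame_hom by (auto simp: frame_hom_def opn_def opens_def)

section \<open>The structure map of the model on \<open>Z\<close> and truth in that model\<close>

text \<open>Sobriety of \<open>T Z\<close> places the point obtained from \<open>\<delta>\<close> in
  the range of \<open>kmap TZ\<close>, so that \<open>inv_into\<close> is a true inverse there. The
  second claim is the working description of \<open>\<zeta>\<close>.\<close>

lemma zeta_spec:
  assumes z: "z \<in> topspace Z"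
  shows "\<zeta> z \<in> topspace TZ" and "openin TZ W \<Longrightarrow> \<zeta> z \<in> W \<longleftrightarrow> point z (\<delta> W)"
proof -
  let ?p = "pt_map (opn TZ) \<delta> (point z)"
  have "?p \<in> frame_hom (opn TZ) two"
    by (rule pt_map_in_frame_hom[OF delta_in_frame_hom point_in_frame_hom[OF z] closed_ops_opn])
  then have p: "?p \<in> kmap TZ ` topspace TZ"
    using sober_TZ by (simp add: sober_iff_bij_betw_kmap bij_betw_def)
  have \<zeta>: "\<zeta> z = inv_into (topspace TZ) (kmap TZ) ?p"
    using z by (simp add: zeta_def point_def)
  show "\<zeta> z \<in> topspace TZ"
    unfolding \<zeta> by (rule inv_into_into[OF p])
  have "kmap TZ (\<zeta> z) = ?p"
    unfolding \<zeta> by (rule f_inv_into_f[OF p])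
  then have "kmap TZ (\<zeta> z) W = ?p W"
    by simp
  then show "openin TZ W \<Longrightarrow> \<zeta> z \<in> W \<longleftrightarrow> point z (\<delta> W)"
    by (simp add: kmap_def pt_map_def compose_def fcarrier_opn opens_def)
qed

lemma zeta_in_top_hom: "\<zeta> \<in> top_hom Z TZ"
proof -
  have "openin Z {z \<in> topspace Z. \<zeta> z \<in> W}" if W: "openin TZ W" for W
  proof -
    obtain \<phi> where \<phi>: "\<phi> \<in> L" "\<delta> W = cls \<phi>"
      using delta_in_carrier[OF W] by (auto simp: fcarrier_E)
    have "{z \<in> topspace Z. \<zeta> z \<in> W} = Zo \<phi>"
      using zeta_spec(2)[OF _ W] \<phi>(2) by (auto simp: mem_Zopen)
    then show ?thesis
      using openin_Zopen[OF \<phi>(1)] by simp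
  qed
  moreover have "\<zeta> \<in> topspace Z \<rightarrow> topspace TZ"
    using zeta_spec(1) by blast
  ultimately have "continuous_map Z TZ \<zeta>"
    unfolding continuous_map_def by blast
  then show ?thesis
    by (simp add: top_hom_def zeta_def)
qed

lemma ZZ_in_Mods: "\<ZZ> \<in> Mods"
  using Z_in_Top zeta_in_top_hom openin_Zopen[OF GML.intros(2)]
  by (auto simp: Mod_ob_def ZZ_def opens_def)

text \<open>Truth and the connectives are handled by the fact that states of \<open>Z\<close> are
  frame points; the modal case combines \<open>zeta_spec\<close> with the value of
  \<open>\<delta>\<close> on generators.\<close>

lemma sem_ZZ: "\<phi> \<in> L \<Longrightarrow> sem \<ZZ> \<phi> = Zo \<phi>"
proof (induction rule: GML.induct)
  case 1
  have "point z (cls Truth)" if "z \<in> topspace Z" for z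
    using point_in_frame_hom[OF that] by (simp add: in_frame_hom_two ftop_E)
  then show ?case
    by (auto simp: ZZ_def mem_Zopen)
next
  case (2 p)
  then show ?case
    by (simp add: ZZ_def)
next
  case (3 \<phi> \<psi>)
  have "point z (cls (Conj \<phi> \<psi>)) \<longleftrightarrow> point z (cls \<phi>) \<and> point z (cls \<psi>)" if "z \<in> topspace Z" for z
    using point_in_frame_hom[OF that] 3(1,2)
    by (simp add: in_frame_hom_two fmeet_cls[symmetric] cls_in_carrier)
  then show ?case
    using 3 by (auto simp: mem_Zopen)
next
  case (4 I f)
  have "point z (cls (Disj I f)) \<longleftrightarrow> (\<exists>i\<in>I. point z (cls (f i)))" if "z \<in> topspace Z" for z
  proof -
    have "Disj I f \<in> L"
      using 4 by (simp add: Disj_GML_iff)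
    moreover have "(\<lambda>i. cls (f i)) ` I \<subseteq> fcarrier E"
      using 4 cls_in_carrier by blast
    ultimately show ?thesis
      using point_in_frame_hom[OF that] by (simp add: in_frame_hom_two fjoin_cls[symmetric])
  qed
  then show ?case
    using 4 by (auto simp: mem_Zopen)
next
  case (5 l \<phi>s)
  have set_L: "set \<phi>s \<subseteq> L"
    using 5 by blast
  have lift_open: "openin TZ (lift l Z (map Zo \<phi>s))"
    using openin_lift[OF 5(1) Z_in_Top] Zopen_open_tuples[OF set_L] 5(2) by simp
  have "map (sem \<ZZ>) \<phi>s = map Zo \<phi>s"
    using 5 by simp
  moreover have "sem \<ZZ> (Heart l \<phi>s) = inv_img Z \<zeta> (lift l Z (map (sem \<ZZ>) \<phi>s))"
    by (simp add: ZZ_def)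
  ultimately have "sem \<ZZ> (Heart l \<phi>s) = inv_img Z \<zeta> (lift l Z (map Zo \<phi>s))"
    by (simp only:)
  then show ?case
    using delta_lift[OF 5(1,2) set_L] zeta_spec(2)[OF _ lift_open]
    by (auto simp only: inv_img_def mem_Zopen)
qed

section \<open>Existence and uniqueness of morphisms into the model on \<open>Z\<close>\<close>

text \<open>By sobriety of \<open>T Z\<close> the square is tested on opens \<open>W\<close>. Along
  both legs, membership of the image of \<open>x\<close> in \<open>W\<close> means that
  \<open>x\<close> lies in the truth set of \<open>\<delta> W\<close>.\<close>

lemma theory_map_in_Mod_hom:
  assumes M: "M \<in> Mods"
  shows "theory_map M \<in> Mod_hom T \<Phi> M \<ZZ>"
proof -
  let ?X = "state_space M"
  have "\<zeta> (theory_map M x) = arr T ?X Z (theory_map M) (structure_map M x)" if x: "x \<in> topspace ?X" for x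
  proof (rule sober_open_ext[OF sober_TZ])
    show "\<zeta> (theory_map M x) \<in> topspace TZ"
      using zeta_spec(1) theory_map_in_topspace[OF M x] by blast
    show "arr T ?X Z (theory_map M) (structure_map M x) \<in> topspace TZ"
      by (rule arr_theory_map_in_TZ(2)[OF M x])
    show "\<zeta> (theory_map M x) \<in> W \<longleftrightarrow> arr T ?X Z (theory_map M) (structure_map M x) \<in> W" if W: "openin TZ W" for W
    proof -
      have "\<zeta> (theory_map M x) \<in> W \<longleftrightarrow> x \<in> csem M (\<delta> W)"
        using zeta_spec(2)[OF theory_map_in_topspace[OF M x] W] point_theory_map[OF M x delta_in_carrier[OF W]] by simp
      then show ?thesis
        using x by (simp add: csem_delta[OF W M] pull_def)
    qed
  qed
  then have "compose (topspace ?X) \<zeta> (theory_map M)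
      = compose (topspace ?X) (arr T ?X Z (theory_map M)) (structure_map M)"
    by (auto simp: compose_def restrict_def)
  moreover have "valuation M p = inv_img ?X (theory_map M) (Zo (Letter p))" if "p \<in> \<Phi>" for p
    using inv_img_theory_map[OF M GML.intros(2)[OF that]] by simp
  ultimately show ?thesis
    using theory_map_in_top_hom[OF M] by (simp add: Mod_hom_def ZZ_def)
qed

text \<open>Morphisms preserve and reflect truth, and a state of \<open>Z\<close> is determined by
  the formulas true there.\<close>

lemma Mod_hom_unique:
  assumes M: "M \<in> Mods" and f: "f \<in> Mod_hom T \<Phi> M \<ZZ>"
  shows "f = theory_map M"
proof (rule extensionalityI)
  have f_hom: "f \<in> top_hom (state_space M) Z"
    using f by (simp add: Mod_hom_def ZZ_def)
  then show "f \<in> extensional (topspace (state_space M))"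
    by (simp add: top_hom_def)
  show "theory_map M \<in> extensional (topspace (state_space M))"
    by (simp add: theory_map_def)
  fix x
  assume x: "x \<in> topspace (state_space M)"
  show "f x = theory_map M x"
  proof (rule Z_ext)
    show "f x \<in> topspace Z"
      using f_hom x by (auto simp: top_hom_def continuous_map_def)
    show "theory_map M x \<in> topspace Z"
      by (rule theory_map_in_topspace[OF M x])
    fix \<phi>
    assume \<phi>: "\<phi> \<in> L"
    have "inv_img (state_space M) f (Zo \<phi>) = inv_img (state_space M) (theory_map M) (Zo \<phi>)"
      using Mod_hom_sem[OF M ZZ_in_Mods f \<phi>] sem_ZZ[OF \<phi>] inv_img_theory_map[OF M \<phi>] by simp
    then show "f x \<in> Zo \<phi> \<longleftrightarrow> theory_map M x \<in> Zo \<phi>"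
      using x by (auto simp: inv_img_def)
  qed
qed

lemma final_ZZ: "final_object Mods (Mod_hom T \<Phi>) \<ZZ>"
  unfolding final_object_def using ZZ_in_Mods theory_map_in_Mod_hom Mod_hom_unique by blast

end

text \<open>The first conjunct guarantees that the second, which speaks of every copy of
  \<open>pt E\<close> in \<open>Top \<U>\<close>, is not vacuous.\<close>

theorem theorem7p14:
  fixes \<U> :: "'u set set"
    and T :: "'u endofun"
    and \<Lambda> :: "'u lifting set"
    and \<Phi> :: "'p set"
  assumes "universe \<U>"
    and "\<exists>A\<in>\<U>. Pow ((UNIV :: nat set) <+> (\<Lambda> <+> \<Phi>)) \<lesssim> A"
    and "endofunctor \<U> T"
    and "preserves_sobriety \<U> T"
    and "modal_signature \<U> T \<Lambda>"
    and "scott_continuous \<U> \<Lambda>"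
    and "characteristic \<U> T \<Lambda>"
  shows "(\<exists>Z h. Z \<in> Top \<U> \<and> homeomorphic_map (pt (EE \<U> T \<Lambda> \<Phi>)) Z h) \<and>
         (\<forall>Z h. Z \<in> Top \<U> \<and> homeomorphic_map (pt (EE \<U> T \<Lambda> \<Phi>)) Z h \<longrightarrow>
            final_object (Mod_ob \<U> T \<Phi>) (Mod_hom T \<Phi>) (ZZ \<U> T \<Lambda> \<Phi> Z h))"
proof -
  interpret geometric_signature \<U> T \<Lambda> \<Phi>
    using assms by unfold_locales
  have "final_object Mods (Mod_hom T \<Phi>) (ZZ \<U> T \<Lambda> \<Phi> Z h)"
    if "Z \<in> Top \<U>" "homeomorphic_map (pt E) Z h" for Z h
  proof -
    interpret final_model \<U> T \<Lambda> \<Phi> Z h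
      using that by unfold_locales
    show ?thesis
      by (rule final_ZZ)
  qed
  then show ?thesis
    using ex_homeomorphic_copy by blast
qed

end
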